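(* Let $n \ge 1$, $l \ge 0$ be integers, $w, X_1,\ldots,X_n$ indeterminates, and for an integer $m\ge 0$ let $$R_m = \prod_{i=1}^n (X_i^{-1}+1+w+X_i)\cdot \frac{\det_{1 \le i, j \le n} \left( X_i^{j-1} (1+X_i)^{j-1} (1+ w X_i)^{n-j} - X_i^{m+2n-j} (1+X_i^{-1})^{j-1} (1+w X_i^{-1})^{n-j} \right)}{\prod_{i=1}^n (1-X_i) \prod_{1 \le i < j \le n} (1-X_i X_j)(X_j-X_i)}.$$ (1) Let $m=2l+1$ and $E_j=(n-j+l+1,\,j-l-2)$ for $j=1,\ldots,n$. Then $R_m = (-1)^{\binom{n+1}{2}} \prod_{i=1}^n X_i^{l}(X_i^{-1}+1+w+X_i)(1+X_i)\cdot \sum_{\mathcal{F}} \operatorname{sign}(\mathcal{F})\operatorname{wt}(\mathcal{F})$, where the sum is over all families $\mathcal{F}$ with endpoints $(E_j)$ whose initial segments are pairwise vertex-disjoint (the same holds with the sum over all families with endpoints $(E_j)$). If $w=1$, the same identity holds with the sum restricted to families of pairwise vertex-disjoint paths. If $w=0$, the identity holds with $E_j$ replaced by $E'_j=(n-j+l+1,\,2j-n-l-2)$ and the sum over families of pairwise vertex-disjoint paths. Moreover, for $w\in\{0,1\}$ (with endpoints $E'_j$ in the case $w=0$), $R_m = \prod_{i=1}^n X_i^{l}(X_i^{-1}+1+w+X_i)(1+X_i) \sum_{\mathcal{F}} (-1)^{\sum_{i: s_i=\alpha_i} i}\operatorname{wt}(\mathcal{F})$, the sum over families of pairwise vertex-disjoint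 paths. (2) Let $m=2l$ and let $E_j=\{(n-j+l+1,\,j-l-2),(n-j+l,\,j-l-1)\}$ be a set of two endpoints, $j=1,\ldots,n$. Then all statements of (1) hold with these endpoint sets, with the overall factor $(-1)^{\binom{n+1}{2}} \prod_{i=1}^n X_i^{l}(X_i^{-1}+1+w+X_i)$ (respectively $\prod_{i=1}^n X_i^{l}(X_i^{-1}+1+w+X_i)$ in the version with sign $(-1)^{\sum_{i:s_i=\alpha_i} i}$), and for $w=0$ with $E'_j=\{(n-j+l+1,\,2j-n-l-2),(n-j+l,\,2j-n-l-1)\}$.
   Context: For $i=1,\ldots,n$ let $\alpha_i=(-3i+1,-i+1)$, $\beta_i=(-i+1,-3i+1)$, $A_i=\{\alpha_i,\beta_i\}$. An admissible path from $s\in A_i$ to a lattice point $e$ is a lattice path consisting of an initial segment from $s$ to a point $P$ on the line $x+y=0$, all of whose points satisfy $x+y\le 0$, using only steps $(1,1),(-1,1)$ if $s=\alpha_i$ and only steps $(1,1),(1,-1)$ if $s=\beta_i$, followed by a segment from $P$ to $e$ using only steps $(1,0),(0,1)$ ($P$ is the last point of the path on $x+y=0$). The weight of such a path, when its endpoint is regarded as the endpoint of index $j$, is the product of: for each step of type $(-1,1)$ or $(1,-1)$ lying on the line $x+y=-2d$ ($d\ge 0$), the factor $X_{d/2+1}$ if $d$ is even and $X_{(d+1)/2}^{-1}$ if $d$ is odd; and for each step $(1,0)$ whose starting point satisfies $x+y\ge j-1$, the factor $w$; all other steps have weight $1$. Given endpoints (or endpoint sets) indexed by $j=1,\ldots,n$,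 a family $\mathcal{F}$ consists of a permutation $\sigma\in\mathcal{S}_n$, a choice $s_i\in A_i$ for each $i$, (in the case of endpoint sets, a choice of endpoint $e_i$ in the $\sigma(i)$-th set), and for each $i$ an admissible path from $s_i$ to the $\sigma(i)$-th endpoint, weighted with index $\sigma(i)$. Its weight $\operatorname{wt}(\mathcal{F})$ is the product of the path weights and $\operatorname{sign}(\mathcal{F})=\operatorname{sgn}\sigma\cdot(-1)^{\#\{i:\, s_i=\beta_i\}}$. *)

theory Defs
  imports
    "HOL-Library.FuncSet"
    "HOL-Library.Product_Plus"
    "HOL-Combinatorics.Permutations"
    "Jordan_Normal_Form.Determinant"
begin

type_synonym point = "int \<times> int"

definition height :: "point \<Rightarrow> int" where
  "height u = fst u + snd u"

definition alpha :: "nat \<Rightarrow> point" where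
  "alpha i = (- 3 * int i + 1, - int i + 1)"

definition beta :: "nat \<Rightarrow> point" where
  "beta i = (- int i + 1, - 3 * int i + 1)"

definition lattice_path :: "point set \<Rightarrow> point \<Rightarrow> point \<Rightarrow> point list \<Rightarrow> bool" where
  "lattice_path S a b p \<longleftrightarrow>
     p \<noteq> [] \<and> hd p = a \<and> last p = b \<and> successively (\<lambda>u v. v - u \<in> S) p"

text \<open>A path is represented by the vertex lists of its initial segment and of its final segment;
  the intermediate point P, the last point of the path on the line x + y = 0, is both the last
  vertex of the first list and the first vertex of the second one.\<close>

type_synonym path = "point list \<times> point list"

definition initial_steps :: "nat \<Rightarrow> point \<Rightarrow> point set" where
  "initial_steps i s = (if s = alpha i then {(1, 1), (-1, 1)} else {(1, 1), (1, -1)})"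

definition admissible_paths :: "nat \<Rightarrow> point \<Rightarrow> point \<Rightarrow> path set" where
  "admissible_paths i s e =
     {(p, q). \<exists>P. height P = 0 \<and>
        lattice_path (initial_steps i s) s P p \<and> (\<forall>u \<in> set p. height u \<le> 0) \<and>
        lattice_path {(1, 0), (0, 1)} P e q}"

definition initial_vertices :: "path \<Rightarrow> point set" where
  "initial_vertices \<pi> = set (fst \<pi>)"

definition vertices :: "path \<Rightarrow> point set" where
  "vertices \<pi> = set (fst \<pi>) \<union> set (snd \<pi>)"

definition level_weight :: "(nat \<Rightarrow> 'a::field) \<Rightarrow> nat \<Rightarrow> 'a" where
  "level_weight X d = (if even d then X (d div 2 + 1) else inverse (X ((d + 1) div 2)))"

definition step_weight :: "(nat \<Rightarrow> 'a::field) \<Rightarrow> 'a \<Rightarrow> nat \<Rightarrow> point \<Rightarrow> point \<Rightarrow> 'a" where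
  "step_weight X w j u v =
     (if v - u \<in> {(-1, 1), (1, -1)} then level_weight X (nat (- height u div 2))
      else if v - u = (1, 0) \<and> height u \<ge> int j - 1 then w
      else 1)"

definition segment_weight :: "(nat \<Rightarrow> 'a::field) \<Rightarrow> 'a \<Rightarrow> nat \<Rightarrow> point list \<Rightarrow> 'a" where
  "segment_weight X w j p = (\<Prod>(u, v)\<leftarrow>zip p (tl p). step_weight X w j u v)"

definition path_weight :: "(nat \<Rightarrow> 'a::field) \<Rightarrow> 'a \<Rightarrow> nat \<Rightarrow> path \<Rightarrow> 'a" where
  "path_weight X w j \<pi> = segment_weight X w j (fst \<pi>) * segment_weight X w j (snd \<pi>)"

record family =
  perm :: "nat \<Rightarrow> nat"
  start :: "nat \<Rightarrow> point"
  endpoint :: "nat \<Rightarrow> point"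
  paths :: "nat \<Rightarrow> path"

text \<open>The argument \<open>E\<close> gives the set of endpoints of each index. A single endpoint is treated as a
  singleton set. The components of a family are extensional functions on \<open>{1..n}\<close>, so
  distinct families differ on \<open>{1..n}\<close>.\<close>

definition families :: "nat \<Rightarrow> (nat \<Rightarrow> point set) \<Rightarrow> family set" where
  "families n E =
     {F. perm F permutes {1..n} \<and>
         start F \<in> (\<Pi>\<^sub>E i\<in>{1..n}. {alpha i, beta i}) \<and>
         endpoint F \<in> (\<Pi>\<^sub>E i\<in>{1..n}. E (perm F i)) \<and>
         paths F \<in> (\<Pi>\<^sub>E i\<in>{1..n}. admissible_paths i (start F i) (endpoint F i))}"

definition initially_disjoint_families :: "nat \<Rightarrow> (nat \<Rightarrow> point set) \<Rightarrow> family set" where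
  "initially_disjoint_families n E =
     {F \<in> families n E. \<forall>i\<in>{1..n}. \<forall>j\<in>{1..n}. i \<noteq> j \<longrightarrow>
        initial_vertices (paths F i) \<inter> initial_vertices (paths F j) = {}}"

definition disjoint_families :: "nat \<Rightarrow> (nat \<Rightarrow> point set) \<Rightarrow> family set" where
  "disjoint_families n E =
     {F \<in> families n E. \<forall>i\<in>{1..n}. \<forall>j\<in>{1..n}. i \<noteq> j \<longrightarrow>
        vertices (paths F i) \<inter> vertices (paths F j) = {}}"

definition family_weight :: "(nat \<Rightarrow> 'a::field) \<Rightarrow> 'a \<Rightarrow> nat \<Rightarrow> family \<Rightarrow> 'a" where
  "family_weight X w n F = (\<Prod>i=1..n. path_weight X w (perm F i) (paths F i))"

definition family_sign :: "nat \<Rightarrow> family \<Rightarrow> int" where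
  "family_sign n F = sign (perm F) * (-1) ^ card {i \<in> {1..n}. start F i = beta i}"

definition alpha_sign :: "nat \<Rightarrow> family \<Rightarrow> int" where
  "alpha_sign n F = (-1) ^ (\<Sum>i | i \<in> {1..n} \<and> start F i = alpha i. i)"

definition E_odd :: "nat \<Rightarrow> nat \<Rightarrow> nat \<Rightarrow> point set" where
  "E_odd n l j = {(int n - int j + int l + 1, int j - int l - 2)}"

definition E'_odd :: "nat \<Rightarrow> nat \<Rightarrow> nat \<Rightarrow> point set" where
  "E'_odd n l j = {(int n - int j + int l + 1, 2 * int j - int n - int l - 2)}"

definition E_even :: "nat \<Rightarrow> nat \<Rightarrow> nat \<Rightarrow> point set" where
  "E_even n l j =
     {(int n - int j + int l + 1, int j - int l - 2),
      (int n - int j + int l, int j - int l - 1)}"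

definition E'_even :: "nat \<Rightarrow> nat \<Rightarrow> nat \<Rightarrow> point set" where
  "E'_even n l j =
     {(int n - int j + int l + 1, 2 * int j - int n - int l - 2),
      (int n - int j + int l, 2 * int j - int n - int l - 1)}"

definition R_entry :: "(nat \<Rightarrow> 'a::field) \<Rightarrow> 'a \<Rightarrow> nat \<Rightarrow> nat \<Rightarrow> nat \<Rightarrow> nat \<Rightarrow> 'a" where
  "R_entry X w n m i j =
     X i ^ (j - 1) * (1 + X i) ^ (j - 1) * (1 + w * X i) ^ (n - j)
     - X i ^ (m + 2 * n - j) * (1 + inverse (X i)) ^ (j - 1) * (1 + w * inverse (X i)) ^ (n - j)"

text \<open>Matrices are indexed from 0, hence the shift of the indices.\<close>

definition R :: "(nat \<Rightarrow> 'a::field) \<Rightarrow> 'a \<Rightarrow> nat \<Rightarrow> nat \<Rightarrow> 'a" where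
  "R X w n m =
     (\<Prod>i=1..n. inverse (X i) + 1 + w + X i) *
     (det (mat n n (\<lambda>(i, j). R_entry X w n m (i + 1) (j + 1))) /
      ((\<Prod>i=1..n. 1 - X i) *
       (\<Prod>i=1..n. \<Prod>j=i+1..n. (1 - X i * X j) * (X j - X i))))"

text \<open>Indeterminates are rendered as elements of an arbitrary field at which the denominators of
  the rational functions involved do not vanish. The generators of a field of rational functions
  in \<open>w, X\<^sub>1, \<dots>, X\<^sub>n\<close>, or in \<open>X\<^sub>1, \<dots>, X\<^sub>n\<close> with \<open>w\<close> specialised to 0 or 1,
  are an instance.\<close>

definition generic :: "nat \<Rightarrow> (nat \<Rightarrow> 'a::field) \<Rightarrow> bool" where
  "generic n X \<longleftrightarrow>
     (\<forall>i\<in>{1..n}. X i \<noteq> 0 \<and> X i \<noteq> 1) \<and>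
     (\<forall>i\<in>{1..n}. \<forall>j\<in>{1..n}. i < j \<longrightarrow> X i * X j \<noteq> 1 \<and> X i \<noteq> X j)"

end

theory Submission
  imports Defs "HOL-Computational_Algebra.Formal_Power_Series"
begin

text \<open>Write \<open>v\<^sub>i = X\<^sub>i + 1/X\<^sub>i\<close>. The initial segments from \<open>beta i\<close> to \<open>(x, -x)\<close>, and from
  \<open>alpha i\<close> to \<open>(-x, x)\<close>, are counted by the coefficient of \<open>z^x\<close> in
  \<open>F\<^sub>i = \<Prod>s\<le>i. z / (1 - v\<^sub>s z + z^2)\<close>, which with \<open>u = z + 1/z\<close> is \<open>\<Prod>s\<le>i. 1 / (u - v\<^sub>s)\<close>; the final
  segments are counted by the coefficients of \<open>(1 + z)^(j-1) (1 + w z)^(n-j)\<close>. So the signed sum over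
  all families is a determinant whose rows depend linearly on \<open>F\<^sub>1, \<dots>, F\<^sub>n\<close>. Newton
  interpolation expresses \<open>1 / (u - v\<^sub>r)\<close> triangularly through the \<open>F\<^sub>i\<close> with diagonal entries
  \<open>\<Prod>s<r. v\<^sub>r - v\<^sub>s\<close>, and the coefficients of \<open>1 / (u - v\<^sub>r)\<close> turn the rows into those of the
  determinant in \<open>R\<close>.

  Exchanging the tails of two paths at a common vertex cancels the families with intersecting
  initial segments. It also cancels those with intersecting final segments whenever the final
  segments all have weight 1, that is for \<open>w = 1\<close>, or for the shortened endpoints when \<open>w = 0\<close>.
  For disjoint families planarity forces the order of the paths, so the starting points
  determine the sign of the permutation.\<close>

subsection \<open>Determinants and resolvents\<close>

text \<open>Each entry of the determinant in \<open>R\<close> is, up to a power of X_i,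
  antisymmetric under X_i -> 1/X_i. Subtracting the paths from \<open>beta i\<close> from those from
  \<open>alpha i\<close> imitates this, because it produces coefficients of F_i(1/z) - F_i(z). For
  even m, adding two neighbouring endpoints yields a factor 1 + 1/X_i that cancels against X_i -
  1/X_i = (X_i - 1)(1 + 1/X_i); this is why the prefactor then lacks 1 + X_i. Since
  \<open>generic\<close> admits X_i = -1, the closed forms are kept multiplied out instead of being
  divided by X_i - 1/X_i. The obstacle to disjoint families for general w is that the threshold j -
  1 belongs to the endpoint: after an exchange of final tails the head is weighted with another
  index. For w = 0 a step (1,0) from height at least j - 1 annihilates the weight, so every
  contributing path to E_j ends with n - j vertical steps. Removing this forced tail gives E'_j, at
  height j - 1, and all remaining final steps have weight 1.\<close>

definition Det :: "nat \<Rightarrow> (nat \<Rightarrow> nat \<Rightarrow> 'a::comm_ring_1) \<Rightarrow> 'a" where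
  "Det n f = (\<Sum>\<sigma> | \<sigma> permutes {1..n}. of_int (sign \<sigma>) * (\<Prod>i=1..n. f i (\<sigma> i)))"

text \<open>Conjugating by the shift k -> k - 1 keeps signs. The 1-based form matches the
  permutations carried by families, the 0-based form the matrix in \<open>R\<close>.\<close>

lemma Det_eq_det: "Det n f = det (mat n n (\<lambda>(i, j). f (i + 1) (j + 1)))"
proof -
  have Suc_img: "Suc ` {0..<n} = {1..n}"
    by (simp add: atLeastLessThanSuc_atLeastAtMost)
  have pred_img: "(\<lambda>k. k - 1) ` {1..n} = {0..<n}"
    using image_image[of "\<lambda>k. k - 1" Suc "{0..<n}"] Suc_img by simp
  have inj: "inj_on (\<lambda>k::nat. k - 1) {1..n}"
    by (auto simp: inj_on_def)
  have "det (mat n n (\<lambda>(i, j). f (i + 1) (j + 1))) =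
      (\<Sum>p | p permutes {0..<n}. of_int (sign p) * (\<Prod>i = 0..<n. f (Suc i) (Suc (p i))))"
    by (subst det_def'[of _ n])
      (auto intro!: sum.cong prod.cong dest: permutes_in_image simp: permutes_in_image)
  also have "\<dots> = Det n f"
    unfolding Det_def
  proof (rule sum.reindex_bij_witness[where i = "map_permutation {1..n} (\<lambda>k. k - 1)"
        and j = "map_permutation {0..<n} Suc"])
    fix p assume p: "p \<in> {p. p permutes {0..<n}}"
    then have p': "p permutes {0..<n}" by simp
    have pb: "bij_betw Suc {0..<n} {1..n}"
      using Suc_img by (simp add: bij_betw_def)
    show "map_permutation {1..n} (\<lambda>k. k - 1) (map_permutation {0..<n} Suc p) = p"
      by (rule map_permutation_compose_inv[OF pb p']) simp
    show "map_permutation {0..<n} Suc p \<in> {\<sigma>. \<sigma> permutes {1..n}}"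
      using map_permutation_permutes[OF pb p'] by simp
    have "(\<Prod>i=1..n. f i (map_permutation {0..<n} Suc p i)) = (\<Prod>i=0..<n. f (Suc i) (Suc (p i)))"
      by (subst Suc_img[symmetric], subst prod.reindex)
        (auto intro!: prod.cong simp: map_permutation_apply)
    then show "of_int (sign (map_permutation {0..<n} Suc p)) *
        (\<Prod>i = 1..n. f i (map_permutation {0..<n} Suc p i)) =
      of_int (sign p) * (\<Prod>i = 0..<n. f (Suc i) (Suc (p i)))"
      using p' by (simp add: sign_map_permutation)
  next
    fix p assume p: "p \<in> {p. p permutes {1..n}}"
    then have p': "p permutes {1..n}" by simp
    have pb: "bij_betw (\<lambda>k. k - 1) {1..n} {0..<n}"
      using pred_img inj by (simp add: bij_betw_def)
    show "map_permutation {1..n} (\<lambda>k. k - 1) p \<in> {p. p permutes {0..<n}}"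
      using map_permutation_permutes[OF pb p'] by simp
    show "map_permutation {0..<n} Suc (map_permutation {1..n} (\<lambda>k. k - 1) p) = p"
      by (rule map_permutation_compose_inv[OF pb p']) simp
  qed
  finally show ?thesis ..
qed

lemma Det_cong:
  assumes "\<And>i j. i \<in> {1..n} \<Longrightarrow> j \<in> {1..n} \<Longrightarrow> f i j = g i j"
  shows "Det n f = Det n g"
  unfolding Det_def
  by (intro sum.cong refl arg_cong2[where f = "(*)"] prod.cong assms) (auto dest: permutes_in_image)

lemma Det_scale_rows: "Det n (\<lambda>i j. c i * f i j) = (\<Prod>i=1..n. c i) * Det n f"
  unfolding Det_def by (simp add: prod.distrib sum_distrib_left mult_ac)

text \<open>The array \<open>f\<close> is a lower triangular matrix times \<open>g\<close>. In the
  application \<open>b\<close> holds the Newton coefficients, and only their diagonal survives in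
  the determinant.\<close>

lemma Det_lower_triangular_mult:
  assumes "\<And>i j. i \<in> {1..n} \<Longrightarrow> j \<in> {1..n} \<Longrightarrow> f i j = (\<Sum>k=1..i. b i k * g k j)"
  shows "Det n f = (\<Prod>i=1..n. b i i) * Det n g"
proof -
  define B where "B = mat n n (\<lambda>(i, k). if k \<le> i then b (i + 1) (k + 1) else 0)"
  define M where "M = mat n n (\<lambda>(i, j). g (i + 1) (j + 1))"
  have "mat n n (\<lambda>(i, j). f (i + 1) (j + 1)) = B * M"
  proof (rule eq_matI)
    fix i j assume ij: "i < dim_row (B * M)" "j < dim_col (B * M)"
    then have ij': "i < n" "j < n" by (auto simp: B_def M_def)
    have "(B * M) $$ (i, j) = (\<Sum>k = 0..<n. B $$ (i, k) * M $$ (k, j))"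
      using ij' by (simp add: B_def M_def scalar_prod_def)
    also have "\<dots> = (\<Sum>k = 0..<n. if k \<le> i then b (i + 1) (k + 1) * g (k + 1) (j + 1) else 0)"
      using ij' by (intro sum.cong) (auto simp: B_def M_def)
    also have "\<dots> = (\<Sum>k = 0..<Suc i. b (i + 1) (k + 1) * g (k + 1) (j + 1))"
      using ij' by (intro sum.mono_neutral_cong_right) auto
    also have "\<dots> = (\<Sum>k = 1..i + 1. b (i + 1) k * g k (j + 1))"
      using sum.shift_bounds_Suc_ivl[of "\<lambda>k. b (i + 1) k * g k (j + 1)" 0 "Suc i"]
      by (simp add: atLeastLessThanSuc_atLeastAtMost)
    also have "\<dots> = f (i + 1) (j + 1)"
      using ij' assms[of "i + 1" "j + 1"] by simp
    finally show "mat n n (\<lambda>(i, j). f (i + 1) (j + 1)) $$ (i, j) = (B * M) $$ (i, j)"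
      using ij' by simp
  qed (auto simp: B_def M_def)
  moreover have "det B = (\<Prod>i=1..n. b i i)"
  proof -
    have "det B = prod_list (diag_mat B)"
      by (rule det_lower_triangular[of n]) (auto simp: B_def)
    also have "\<dots> = (\<Prod>i=0..<n. b (i + 1) (i + 1))"
      by (subst prod_list_diag_prod) (auto simp: B_def intro!: prod.cong)
    also have "\<dots> = (\<Prod>i=1..n. b i i)"
      using prod.shift_bounds_Suc_ivl[of "\<lambda>i. b i i" 0 n]
      by (simp add: atLeastLessThanSuc_atLeastAtMost)
    finally show ?thesis .
  qed
  moreover have "det (B * M) = det B * det M"
    by (rule det_mult[of _ n]) (auto simp: B_def M_def)
  ultimately show ?thesis
    by (simp add: Det_eq_det M_def)
qed

text \<open>In terms of \<open>u = z + 1/z\<close> this is \<open>1 / (u - v)\<close>.\<close>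

definition resolvent :: "'a::field \<Rightarrow> 'a fps" where
  "resolvent v = fps_X * inverse (1 - fps_const v * fps_X + fps_X ^ 2)"

lemma resolvent_mult: "resolvent v * (1 - fps_const v * fps_X + fps_X ^ 2) = fps_X"
  unfolding resolvent_def by (subst mult.assoc, subst inverse_mult_eq_1) auto

text \<open>The resolvent identity 1/(u - a) - 1/(u - b) = (a - b)/((u - a)(u - b)), read off over
  the common denominator; \<open>D v\<close> is z (u - v).\<close>

lemma resolvent_diff: "resolvent a - resolvent b = fps_const (a - b) * resolvent a * resolvent b"
proof -
  define D where "D v = 1 - fps_const v * fps_X + fps_X ^ 2" for v :: 'a
  have [simp]: "D v * inverse (D v) = 1" for v
    by (rule inverse_mult_eq_1') (simp add: D_def)
  have resolvent: "resolvent v = fps_X * inverse (D v)" for v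
    by (simp add: resolvent_def D_def)
  have "resolvent a - resolvent b = fps_X * inverse (D a) * (D b * inverse (D b))
      - fps_X * inverse (D b) * (D a * inverse (D a))"
    by (simp add: resolvent)
  also have "\<dots> = fps_X * inverse (D a) * inverse (D b) * (D b - D a)"
    by (simp add: algebra_simps)
  also have "D b - D a = fps_const (a - b) * fps_X"
    by (simp add: D_def algebra_simps flip: fps_const_sub)
  finally show ?thesis
    by (simp add: resolvent mult_ac)
qed

text \<open>Newton interpolation with remainder: the resolvent identity, in the form g_u = g_v + (u
  - v) g_v g_u, is applied again and again to the trailing factor g_u.\<close>

lemma resolvent_newton_remainder:
  fixes r :: nat
  shows "resolvent u = (\<Sum>i=1..r. fps_const (\<Prod>s\<in>{1..<i}. u - v s) * (\<Prod>s=1..i. resolvent (v s)))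
       + fps_const (\<Prod>s=1..r. u - v s) * (\<Prod>s=1..r. resolvent (v s)) * resolvent u"
proof (induction r)
  case 0
  then show ?case by simp
next
  case (Suc r)
  have split: "resolvent u = resolvent (v (Suc r)) + fps_const (u - v (Suc r)) * resolvent (v (Suc r)) * resolvent u"
    using resolvent_diff[of u "v (Suc r)"] by (simp add: algebra_simps)
  have "fps_const (\<Prod>s=1..r. u - v s) * (\<Prod>s=1..r. resolvent (v s)) * resolvent u =
     fps_const (\<Prod>s\<in>{1..<Suc r}. u - v s) * (\<Prod>s=1..Suc r. resolvent (v s)) +
     fps_const (\<Prod>s=1..Suc r. u - v s) * (\<Prod>s=1..Suc r. resolvent (v s)) * resolvent u"
    by (subst (1) split)
      (simp add: atLeastLessThanSuc_atLeastAtMost distrib_left mult_ac flip: fps_const_mult)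
  then show ?case
    by (subst Suc.IH) (simp del: prod.op_ivl_Suc)
qed

text \<open>At the node \<open>v r\<close> the remainder contains the factor v_r - v_r. The last
  coefficient, the product of v_r - v_s over s < r, becomes a diagonal entry of the triangular
  matrix.\<close>

lemma resolvent_newton:
  fixes r :: nat
  assumes "r \<ge> 1"
  shows "resolvent (v r) = (\<Sum>i=1..r. fps_const (\<Prod>s\<in>{1..<i}. v r - v s) * (\<Prod>s=1..i. resolvent (v s)))"
proof -
  have "(\<Prod>s=1..r. v r - v s) = 0"
    using assms by (intro prod_zero) auto
  then show ?thesis
    using resolvent_newton_remainder[of "v r" v r] by (simp del: prod_zero_iff)
qed

definition int_nth :: "'a::zero fps \<Rightarrow> int \<Rightarrow> 'a" where
  "int_nth f k = (if k < 0 then 0 else fps_nth f (nat k))"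

text \<open>The coefficient of \<open>z^x\<close> in \<open>f(1/z) - f(z)\<close>.\<close>

definition odd_nth :: "'a::field fps \<Rightarrow> int \<Rightarrow> 'a" where
  "odd_nth f x = int_nth f (- x) - int_nth f x"

lemma odd_nth_add: "odd_nth (f + g) x = odd_nth f x + odd_nth g x"
  and odd_nth_const_mult: "odd_nth (fps_const c * f) x = c * odd_nth f x"
  by (auto simp: odd_nth_def int_nth_def algebra_simps)

lemma odd_nth_sum: "finite A \<Longrightarrow> odd_nth (\<Sum>i\<in>A. f i) x = (\<Sum>i\<in>A. odd_nth (f i) x)"
  by (induction A rule: finite_induct) (auto simp: odd_nth_add, simp add: odd_nth_def int_nth_def)

text \<open>The denominator 1 - v z + z^2 gives the Chebyshev recurrence: coefficient k + 1 is
  U_k(v/2), a Chebyshev polynomial of the second kind.\<close>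

lemma resolvent_nth_0: "fps_nth (resolvent v) 0 = 0"
  and resolvent_nth_1: "fps_nth (resolvent v) 1 = 1"
  and resolvent_nth_Suc_Suc: "fps_nth (resolvent v) (Suc (Suc k)) = v * fps_nth (resolvent v) (Suc k) - fps_nth (resolvent v) k"
proof -
  have eq: "resolvent v = fps_X + fps_X * (fps_const v * resolvent v) - fps_X * (fps_X * resolvent v)"
    using resolvent_mult[of v] by (simp add: algebra_simps power2_eq_square)
  show 0: "fps_nth (resolvent v) 0 = 0"
    by (subst eq) simp
  show "fps_nth (resolvent v) 1 = 1"
    by (subst eq) (simp add: 0)
  show "fps_nth (resolvent v) (Suc (Suc k)) = v * fps_nth (resolvent v) (Suc k) - fps_nth (resolvent v) k"
    by (subst eq) simp
qed

text \<open>For v = x + 1/x the characteristic roots of the recurrence are x and 1/x. The factor x -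
  1/x stays on the left because it may vanish.\<close>

lemma resolvent_nth_odd:
  fixes x :: "'a::field"
  assumes "x \<noteq> 0"
  shows "(x - inverse x) * fps_nth (resolvent (x + inverse x)) k = x ^ k - inverse x ^ k"
proof (induction k rule: induct_nat_012)
  case (ge2 k)
  let ?g = "\<lambda>k. fps_nth (resolvent (x + inverse x)) k"
  have "(x - inverse x) * ?g (Suc (Suc k)) =
     (x + inverse x) * ((x - inverse x) * ?g (Suc k)) - (x - inverse x) * ?g k"
    by (simp add: resolvent_nth_Suc_Suc algebra_simps)
  also have "\<dots> = x ^ Suc (Suc k) - inverse x ^ Suc (Suc k)"
    using assms by (simp only: ge2) (simp add: field_simps)
  finally show ?case .
qed (auto simp: resolvent_nth_0 resolvent_nth_1[simplified])

text \<open>Dividing the sum of two neighbouring instances of \<open>resolvent_nth_odd\<close> by 1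
  + 1/x suggests this formula. At x = -1 that division is impossible, so the recurrence is used
  directly.\<close>

lemma resolvent_nth_even:
  fixes x :: "'a::field"
  assumes "x \<noteq> 0"
  shows "(x - 1) * (fps_nth (resolvent (x + inverse x)) (Suc k) + fps_nth (resolvent (x + inverse x)) k) = x ^ Suc k - inverse x ^ k"
proof (induction k rule: induct_nat_012)
  case (ge2 k)
  let ?g = "\<lambda>k. fps_nth (resolvent (x + inverse x)) k"
  have "(x - 1) * (?g (Suc (Suc (Suc k))) + ?g (Suc (Suc k))) =
     (x + inverse x) * ((x - 1) * (?g (Suc (Suc k)) + ?g (Suc k))) - (x - 1) * (?g (Suc k) + ?g k)"
    by (simp add: resolvent_nth_Suc_Suc algebra_simps)
  also have "\<dots> = x ^ Suc (Suc (Suc k)) - inverse x ^ Suc (Suc k)"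
    using assms by (simp only: ge2) (simp add: field_simps)
  finally show ?case .
next
  case 1
  then show ?case using assms by (simp add: resolvent_nth_0 resolvent_nth_1[simplified] resolvent_nth_Suc_Suc[of _ 0, simplified] field_simps)
qed (auto simp: resolvent_nth_0 resolvent_nth_1[simplified])

lemma odd_nth_resolvent:
  fixes x :: "'a::field"
  assumes "x \<noteq> 0"
  shows "(x - inverse x) * odd_nth (resolvent (x + inverse x)) k = x powi (- k) - x powi k"
proof (cases "k < 0")
  case True
  then show ?thesis
    using assms resolvent_nth_odd[OF assms, of "nat (- k)"]
    by (simp add: odd_nth_def int_nth_def power_int_def)
next
  case False
  then show ?thesis
    using assms resolvent_nth_odd[OF assms, of "nat k"]
    by (cases "k = 0") (auto simp: odd_nth_def int_nth_def power_int_def algebra_simps)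
qed

lemma odd_nth_resolvent_pair:
  fixes x :: "'a::field"
  assumes "x \<noteq> 0"
  shows "(x - 1) * (odd_nth (resolvent (x + inverse x)) k + odd_nth (resolvent (x + inverse x)) (k - 1)) =
    x powi (1 - k) - x powi k"
proof (cases "k \<ge> 1")
  case True
  define m where "m = nat (k - 1)"
  have k: "k = int m + 1" using True by (simp add: m_def)
  have "nat (1 + int m) = Suc m" by simp
  then show ?thesis
    using resolvent_nth_even[OF assms, of m] assms
    by (cases "m = 0") (auto simp: resolvent_nth_0 odd_nth_def int_nth_def power_int_def algebra_simps k)
next
  case False
  define m where "m = nat (- k)"
  have k: "k = - int m" using False by (simp add: m_def)
  have "nat (1 + int m) = Suc m" by simp
  then show ?thesis
    using resolvent_nth_even[OF assms, of m] assms
    by (cases "m = 0") (auto simp: resolvent_nth_0 odd_nth_def int_nth_def power_int_def algebra_simps k)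
qed

lemma poly_eq_sum_bound:
  fixes p :: "'a::comm_semiring_1 poly"
  assumes "degree p \<le> H"
  shows "poly p x = (\<Sum>t\<le>H. coeff p t * x ^ t)"
  unfolding poly_altdef using assms
  by (intro sum.mono_neutral_left) (auto simp: coeff_eq_0)

lemma sum_coeff_powi:
  fixes x :: "'a::field"
  assumes "x \<noteq> 0" and "degree p \<le> H"
  shows "(\<Sum>t\<le>H. coeff p t * x powi (a + int t)) = x powi a * poly p x"
    and "(\<Sum>t\<le>H. coeff p t * x powi (a - int t)) = x powi a * poly p (inverse x)"
  using assms
  by (auto simp: poly_eq_sum_bound sum_distrib_left power_int_add power_int_diff power_inverse
      divide_inverse mult_ac intro!: sum.cong)

subsection \<open>Weighted counts of lattice paths\<close>

lemma lattice_path_Nil [simp]: "\<not> lattice_path S a b []"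
  by (simp add: lattice_path_def)

lemma lattice_path_Cons:
  "lattice_path S a b (u # p) \<longleftrightarrow>
     u = a \<and> (if p = [] then a = b else \<exists>s\<in>S. lattice_path S (a + s) b p)"
proof (cases p)
  case (Cons v q)
  then show ?thesis
    by (auto simp: lattice_path_def algebra_simps intro!: bexI[of _ "v - a"])
qed (auto simp: lattice_path_def)

lemma lattice_path_strict_mono:
  assumes "lattice_path S a b p" and "\<And>u s. s \<in> S \<Longrightarrow> f u < (f (u + s) :: int)"
  shows "sorted_wrt (\<lambda>u v. f u < f v) p"
proof -
  have "f u < f v" if "v - u \<in> S" for u v
    using assms(2)[OF that, of u] by simp
  then have "successively (\<lambda>u v. f u < f v) p"
    using assms(1) unfolding lattice_path_def by (blast intro: successively_mono)
  then show ?thesis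
    by (subst (asm) successively_conv_sorted_wrt) (auto intro: transpI)
qed

lemma segment_weight_Cons:
  "p \<noteq> [] \<Longrightarrow> segment_weight X w j (a # p) = step_weight X w j a (hd p) * segment_weight X w j p"
  by (cases p) (auto simp: segment_weight_def)

lemma segment_weight_singleton [simp]: "segment_weight X w j [a] = 1"
  by (simp add: segment_weight_def)

definition bounded_paths :: "point set \<Rightarrow> (point \<Rightarrow> bool) \<Rightarrow> point \<Rightarrow> point \<Rightarrow> point list set" where
  "bounded_paths S Q a b = {p. lattice_path S a b p \<and> (\<forall>u\<in>set p. Q u)}"

lemma bounded_paths_rec:
  assumes "Q a"
  shows "bounded_paths S Q a b =
    (if a = b then {[a]} else {}) \<union> (\<Union>s\<in>S. (#) a ` bounded_paths S Q (a + s) b)"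
proof (rule subset_antisym; rule subsetI)
  fix p assume p: "p \<in> bounded_paths S Q a b"
  then obtain q where q: "p = a # q"
    by (cases p) (auto simp: bounded_paths_def lattice_path_def)
  with p show "p \<in> (if a = b then {[a]} else {}) \<union> (\<Union>s\<in>S. (#) a ` bounded_paths S Q (a + s) b)"
    by (auto simp: bounded_paths_def lattice_path_Cons split: if_splits)
next
  fix p assume "p \<in> (if a = b then {[a]} else {}) \<union> (\<Union>s\<in>S. (#) a ` bounded_paths S Q (a + s) b)"
  with assms show "p \<in> bounded_paths S Q a b"
    by (auto simp: bounded_paths_def lattice_path_Cons split: if_splits)
qed

lemma Nil_not_in_bounded_paths [simp]: "[] \<notin> bounded_paths S Q a b"
  by (simp add: bounded_paths_def)

lemma bounded_paths_outside: "\<not> Q a \<Longrightarrow> bounded_paths S Q a b = {}"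
  by (auto simp: bounded_paths_def lattice_path_def)

lemma sum_bounded_paths_rec:
  assumes "Q a" and "finite S" and fin: "\<And>s. s \<in> S \<Longrightarrow> finite (bounded_paths S Q (a + s) b)"
  shows "finite (bounded_paths S Q a b)"
    and "(\<Sum>p\<in>bounded_paths S Q a b. segment_weight X w j p) = of_bool (a = b) +
      (\<Sum>s\<in>S. step_weight X w j a (a + s) * (\<Sum>p\<in>bounded_paths S Q (a + s) b. segment_weight X w j p))"
proof -
  note rec = bounded_paths_rec[where Q = Q, OF assms(1), of S b]
  show "finite (bounded_paths S Q a b)"
    unfolding rec using assms by auto
  have hd_eq: "p \<noteq> []" "hd p = a + s" if "p \<in> bounded_paths S Q (a + s) b" for p s
    using that by (auto simp: bounded_paths_def lattice_path_def)
  have "(\<Sum>p\<in>bounded_paths S Q a b. segment_weight X w j p) =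
      (\<Sum>p\<in>(if a = b then {[a]} else {}). segment_weight X w j p) +
      (\<Sum>p\<in>(\<Union>s\<in>S. (#) a ` bounded_paths S Q (a + s) b). segment_weight X w j p)"
    unfolding rec using assms hd_eq(1) by (intro sum.union_disjoint) (auto split: if_splits)
  also have "(\<Sum>p\<in>(if a = b then {[a]} else {}). segment_weight X w j p) = of_bool (a = b)"
    by simp
  also have "(\<Sum>p\<in>(\<Union>s\<in>S. (#) a ` bounded_paths S Q (a + s) b). segment_weight X w j p) =
      (\<Sum>s\<in>S. \<Sum>p\<in>(#) a ` bounded_paths S Q (a + s) b. segment_weight X w j p)"
  proof (rule sum.UNION_disjoint)
    show "\<forall>i\<in>S. \<forall>k\<in>S. i \<noteq> k \<longrightarrow>
        (#) a ` bounded_paths S Q (a + i) b \<inter> (#) a ` bounded_paths S Q (a + k) b = {}"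
    proof (intro ballI impI)
      fix i k :: point assume "i \<noteq> k"
      then show "(#) a ` bounded_paths S Q (a + i) b \<inter> (#) a ` bounded_paths S Q (a + k) b = {}"
        using hd_eq(2)[of _ i] hd_eq(2)[of _ k] by (force simp del: add_left_cancel)
    qed
  qed (use assms in auto)
  also have "\<dots> = (\<Sum>s\<in>S. step_weight X w j a (a + s) *
      (\<Sum>p\<in>bounded_paths S Q (a + s) b. segment_weight X w j p))"
  proof (rule sum.cong[OF refl])
    fix s assume "s \<in> S"
    show "(\<Sum>p\<in>(#) a ` bounded_paths S Q (a + s) b. segment_weight X w j p) =
      step_weight X w j a (a + s) * (\<Sum>p\<in>bounded_paths S Q (a + s) b. segment_weight X w j p)"
      by (subst sum.reindex)
        (auto simp: segment_weight_Cons hd_eq sum_distrib_left intro!: sum.cong)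
  qed
  finally show "(\<Sum>p\<in>bounded_paths S Q a b. segment_weight X w j p) = of_bool (a = b) +
      (\<Sum>s\<in>S. step_weight X w j a (a + s) * (\<Sum>p\<in>bounded_paths S Q (a + s) b. segment_weight X w j p))" .
qed

lemma int_nth_neg [simp]: "k < 0 \<Longrightarrow> int_nth f k = 0"
  by (simp add: int_nth_def)

lemma int_nth_linear_mult:
  fixes c :: "'a::field"
  shows "int_nth ((1 + fps_const c * fps_X) * f) k = int_nth f k + c * int_nth f (k - 1)"
proof (cases "k > 0")
  case True
  then obtain m where "k = int (Suc m)"
    by (metis gr0_implies_Suc zero_less_imp_eq_int)
  then show ?thesis
    by (simp add: int_nth_def distrib_right mult.assoc nat_add_distrib)
qed (auto simp: int_nth_def distrib_right mult.assoc)

text \<open>The parameter \<open>\<epsilon> = -1\<close> gives the paths from \<open>alpha\<close>, and \<open>\<epsilon> = 1\<close> those from \<open>beta\<close>.\<close>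

definition initial_paths :: "int \<Rightarrow> point \<Rightarrow> point \<Rightarrow> point list set" where
  "initial_paths \<epsilon> = bounded_paths {(1, 1), (\<epsilon>, - \<epsilon>)} (\<lambda>u. height u \<le> 0)"

definition final_paths :: "point \<Rightarrow> point \<Rightarrow> point list set" where
  "final_paths = bounded_paths {(1, 0), (0, 1)} (\<lambda>u. True)"

lemma height_add: "height (u + v) = height u + height v"
  by (simp add: height_def)

text \<open>The coefficient of z^k is the complete homogeneous symmetric polynomial of degree k in
  the weights of levels 0 to d. A step (1,1) passes from level d to level d - 1, and on each level
  any number of weighted steps may be made, hence one geometric series per level.\<close>

definition level_fps :: "(nat \<Rightarrow> 'a::field) \<Rightarrow> nat \<Rightarrow> 'a fps" where
  "level_fps X d = (\<Prod>e\<le>d. inverse (1 - fps_const (level_weight X e) * fps_X))"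

lemma level_fps_rec:
  "int_nth (level_fps X d) k = level_weight X d * int_nth (level_fps X d) (k - 1) +
     (if d = 0 then of_bool (k = 0) else int_nth (level_fps X (d - 1)) k)"
proof -
  let ?D = "1 - fps_const (level_weight X d) * fps_X"
  have inv: "?D * inverse ?D = 1"
    by (rule inverse_mult_eq_1') simp
  have "?D * level_fps X d = (if d = 0 then 1 else level_fps X (d - 1))"
  proof (cases d)
    case 0
    with inv show ?thesis by (simp add: level_fps_def)
  next
    case (Suc e)
    then have "level_fps X d = level_fps X e * inverse ?D"
      by (simp add: level_fps_def)
    with inv Suc show ?thesis by (simp add: mult_ac)
  qed
  then have "int_nth (?D * level_fps X d) k =
      (if d = 0 then of_bool (k = 0) else int_nth (level_fps X (d - 1)) k)"
    by (auto simp: int_nth_def)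
  moreover have "int_nth (?D * level_fps X d) k =
      int_nth (level_fps X d) k - level_weight X d * int_nth (level_fps X d) (k - 1)"
    using int_nth_linear_mult[of "- level_weight X d" "level_fps X d" k] 
    by (simp flip: fps_const_neg)
  ultimately show ?thesis by (simp add: algebra_simps)
qed

text \<open>Steps (1,1) keep x - y, and weighted steps raise \<epsilon> (x - y) by 2. This bounds
  the number of weighted steps and later keeps the path on one side of the diagonal x = y.\<close>

lemma initial_paths_mono:
  assumes "\<epsilon> \<in> {1, -1}" "p \<in> initial_paths \<epsilon> a b"
  shows "\<epsilon> * (fst a - snd a) \<le> \<epsilon> * (fst b - snd b)"
proof -
  have "lattice_path {(1, 1), (\<epsilon>, - \<epsilon>)} a b p"
    using assms by (simp add: initial_paths_def bounded_paths_def)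
  then show ?thesis
  proof (induction p arbitrary: a)
    case (Cons u p)
    show ?case
    proof (cases "p = []")
      case False
      then obtain s where "s \<in> {(1, 1), (\<epsilon>, - \<epsilon>)}" "lattice_path {(1, 1), (\<epsilon>, - \<epsilon>)} (a + s) b p"
        using Cons.prems by (auto simp: lattice_path_Cons)
      with Cons.IH[of "a + s"] assms(1) show ?thesis
        by auto
    qed (use Cons.prems in \<open>auto simp: lattice_path_Cons\<close>)
  qed (simp add: lattice_path_def)
qed

text \<open>Here k is the number of weighted steps: the d steps (1,1) raise x by d, and each
  weighted step changes it by \<epsilon>. Splitting off the first step reproduces
  \<open>level_fps_rec\<close>.\<close>

lemma sum_initial_paths:
  assumes eps: "\<epsilon> \<in> {1, -1}"
    and "height a = - 2 * int d" "height b = 0" "k = \<epsilon> * (fst b - fst a - int d)"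
  shows "finite (initial_paths \<epsilon> a b) \<and>
    (\<Sum>p\<in>initial_paths \<epsilon> a b. segment_weight X w j p) = int_nth (level_fps X d) k"
  using assms(2-)
proof (induction d arbitrary: a k rule: less_induct)
  case (less d)
  let ?W = "\<lambda>a. \<Sum>p\<in>initial_paths \<epsilon> a b. segment_weight X w j p"
  have up: "finite (initial_paths \<epsilon> (a + (1, 1)) b) \<and>
      ?W (a + (1, 1)) = (if d = 0 then 0 else int_nth (level_fps X (d - 1)) k)"
    if "height a = - 2 * int d" "k = \<epsilon> * (fst b - fst a - int d)" for a k
  proof (cases d)
    case 0
    then have "initial_paths \<epsilon> (a + (1, 1)) b = {}"
      unfolding initial_paths_def using that
      by (intro bounded_paths_outside) (simp add: height_add, simp add: height_def)
    with 0 show ?thesis by simp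
  next
    case (Suc e)
    then show ?thesis
      using that less.IH[of e "a + (1, 1)" k] less.prems(2)
      by (simp add: height_add) (simp add: height_def algebra_simps)
  qed
  \<comment> \<open>A weighted step keeps the level and lowers k by one, so for fixed d there is an
    inner induction on a bound for k. It starts at k < 0, where monotonicity excludes every
    path.\<close>
  have "finite (initial_paths \<epsilon> a b) \<and> ?W a = int_nth (level_fps X d) k"
    if "height a = - 2 * int d" "k = \<epsilon> * (fst b - fst a - int d)" "k < int K" for a k K
    using that
  proof (induction K arbitrary: a k)
    case 0
    have "initial_paths \<epsilon> a b = {}"
    proof (rule ccontr)
      assume "initial_paths \<epsilon> a b \<noteq> {}"
      then obtain p where "p \<in> initial_paths \<epsilon> a b" by blast
      from initial_paths_mono[OF eps this] 0 eps less.prems(2) show False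
        by (auto simp: height_def)
    qed
    with 0 show ?case by simp
  next
    case (Suc K)
    have flat: "finite (initial_paths \<epsilon> (a + (\<epsilon>, - \<epsilon>)) b) \<and>
        ?W (a + (\<epsilon>, - \<epsilon>)) = int_nth (level_fps X d) (k - 1)"
      using Suc.prems eps
      by (intro Suc.IH) (auto simp: height_def algebra_simps)
    note up = up[OF Suc.prems(1,2)]
    have fin: "finite (initial_paths \<epsilon> (a + s) b)" if "s \<in> {(1, 1), (\<epsilon>, - \<epsilon>)}" for s
      using that flat up by auto
    have a0: "height a \<le> 0" using Suc.prems by simp
    note rec = sum_bounded_paths_rec[where Q = "\<lambda>u. height u \<le> 0", OF a0, where S = "{(1, 1), (\<epsilon>, - \<epsilon>)}" and b = b,
        folded initial_paths_def, OF _ fin]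
    have ne: "(1, 1) \<noteq> (\<epsilon>, - \<epsilon>)" using eps by auto
    have wt: "step_weight X w j a (a + (1, 1)) = 1"
        "step_weight X w j a (a + (\<epsilon>, - \<epsilon>)) = level_weight X d"
      using eps Suc.prems(1) by (auto simp: step_weight_def)
    have ab: "a = b \<longleftrightarrow> d = 0 \<and> k = 0"
      using eps Suc.prems less.prems(2) by (auto simp: height_def prod_eq_iff)
    have "?W a = of_bool (a = b) + (?W (a + (1, 1)) + level_weight X d * ?W (a + (\<epsilon>, - \<epsilon>)))"
      using ne by (subst rec(2)) (auto simp: wt)
    also have "\<dots> = int_nth (level_fps X d) k"
      using flat up by (subst level_fps_rec) (auto simp: ab)
    finally show ?case using rec(1) by auto
  qed
  from this[of a k "nat (k + 1)"] less.prems show ?case by auto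
qed

text \<open>The weight of a step (1,0) depends only on the height at which it starts, and each
  height is left exactly once. So each height contributes a factor 1 + c z, with z marking
  horizontal steps.\<close>

definition final_poly :: "(int \<Rightarrow> 'a::comm_ring_1) \<Rightarrow> int \<Rightarrow> nat \<Rightarrow> 'a poly" where
  "final_poly c h m = (\<Prod>t<m. [:1, c (h + int t):])"

definition int_coeff :: "'a::zero poly \<Rightarrow> int \<Rightarrow> 'a" where
  "int_coeff p k = (if k < 0 then 0 else coeff p (nat k))"

lemma int_coeff_linear_mult:
  fixes c :: "'a::comm_ring_1"
  shows "int_coeff ([:1, c:] * p) k = int_coeff p k + c * int_coeff p (k - 1)"
proof (cases "k > 0")
  case True
  then obtain m where "k = int (Suc m)"
    by (metis gr0_implies_Suc zero_less_imp_eq_int)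
  then show ?thesis
    by (simp add: int_coeff_def nat_add_distrib)
qed (auto simp: int_coeff_def)

lemma final_poly_Suc: "final_poly c h (Suc m) = [:1, c h:] * final_poly c (h + 1) m"
  unfolding final_poly_def
  by (subst prod.lessThan_Suc_shift) (simp add: algebra_simps del: mult_pCons_left)

lemma final_path_bounds:
  assumes "lattice_path {(1, 0), (0, 1)} a b p" and "u \<in> set p"
  shows "height a \<le> height u" "height u \<le> height b" "fst a \<le> fst u" "fst u \<le> fst b"
    "snd a \<le> snd u" "snd u \<le> snd b"
proof -
  have "height a \<le> height u \<and> height u \<le> height b \<and> fst a \<le> fst u \<and> fst u \<le> fst b
      \<and> snd a \<le> snd u \<and> snd u \<le> snd b"
    using assms
  proof (induction p arbitrary: a u)
    case (Cons v p)
    show ?case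
    proof (cases "p = []")
      case False
      then obtain s where s: "s \<in> {(1, 0), (0, 1)}" "lattice_path {(1, 0), (0, 1)} (a + s) b p"
        using Cons.prems by (auto simp: lattice_path_Cons)
      have "hd p = a + s" "hd p \<in> set p"
        using s(2) False hd_in_set[OF False] by (auto simp: lattice_path_def)
      with Cons.IH[OF s(2), of "a + s"] have *: "height (a + s) \<le> height b" "fst (a + s) \<le> fst b" "snd (a + s) \<le> snd b"
        by auto
      show ?thesis
      proof (cases "u = a")
        case True
        with * s(1) show ?thesis by (auto simp: height_def)
      next
        case False
        with Cons.prems have "u \<in> set p" by (auto simp: lattice_path_Cons)
        with Cons.IH[OF s(2), of u] s(1) show ?thesis by (auto simp: height_def)
      qed
    qed (use Cons.prems in \<open>auto simp: lattice_path_Cons\<close>)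
  qed simp
  then show "height a \<le> height u" "height u \<le> height b" "fst a \<le> fst u" "fst u \<le> fst b"
    "snd a \<le> snd u" "snd u \<le> snd b"
    by auto
qed

lemma sum_final_paths:
  assumes "height b = height a + int m"
  shows "finite (final_paths a b) \<and>
    (\<Sum>p\<in>final_paths a b. segment_weight X w j p) =
      int_coeff (final_poly (\<lambda>h. if h \<ge> int j - 1 then w else 1) (height a) m) (fst b - fst a)"
  using assms
proof (induction m arbitrary: a)
  case 0
  have "final_paths (a + s) b = {}" if "s \<in> {(1, 0), (0, 1)}" for s
  proof (rule ccontr)
    assume "final_paths (a + s) b \<noteq> {}"
    then obtain p where "lattice_path {(1, 0), (0, 1)} (a + s) b p"
      by (auto simp: final_paths_def bounded_paths_def)
    from final_path_bounds(1)[OF this, of b] this 0 that show False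
      by (auto simp: height_def lattice_path_def)
  qed
  then have "finite (final_paths a b)"
    "(\<Sum>p\<in>final_paths a b. segment_weight X w j p) = of_bool (a = b)"
    using sum_bounded_paths_rec[where Q = "\<lambda>u. True", OF TrueI, where S = "{(1, 0), (0, 1)}"
        and a = a and b = b, folded final_paths_def]
    by auto
  moreover have "a = b \<longleftrightarrow> fst b - fst a = 0"
    using 0 by (auto simp: height_def prod_eq_iff)
  ultimately show ?case
    by (auto simp: int_coeff_def final_poly_def)
next
  case (Suc m)
  have IH: "finite (final_paths (a + s) b) \<and>
    (\<Sum>p\<in>final_paths (a + s) b. segment_weight X w j p) =
      int_coeff (final_poly (\<lambda>h. if h \<ge> int j - 1 then w else 1) (height a + 1) m) (fst b - fst a - fst s)"
    if "s \<in> {(1, 0), (0, 1)}" for s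
    using Suc.IH[of "a + s"] Suc.prems that by (auto simp: height_def algebra_simps)
  note rec = sum_bounded_paths_rec[where Q = "\<lambda>u. True", OF TrueI, where S = "{(1, 0), (0, 1)}" and a = a and b = b,
        folded final_paths_def]
  have "a \<noteq> b" using Suc.prems by auto
  then have "(\<Sum>p\<in>final_paths a b. segment_weight X w j p) =
     step_weight X w j a (a + (1, 0)) * (\<Sum>p\<in>final_paths (a + (1, 0)) b. segment_weight X w j p) +
     step_weight X w j a (a + (0, 1)) * (\<Sum>p\<in>final_paths (a + (0, 1)) b. segment_weight X w j p)"
    using IH by (subst rec(2)) auto
  then show ?case
    using IH rec(1) unfolding final_poly_Suc int_coeff_linear_mult
    by (auto simp: step_weight_def)
qed

lemma alpha_neq_beta: "i \<ge> 1 \<Longrightarrow> alpha i \<noteq> beta i"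
  by (auto simp: alpha_def beta_def)

lemma initial_steps_alpha: "initial_steps i (alpha i) = {(1, 1), (-1, - (-1))}"
  and initial_steps_beta: "i \<ge> 1 \<Longrightarrow> initial_steps i (beta i) = {(1, 1), (1, - 1)}"
  using alpha_neq_beta[of i] by (auto simp: initial_steps_def)

text \<open>The point on x + y = 0 is determined by the number t of steps (1,0) in the final
  segment, which has \<open>H\<close> steps altogether.\<close>

lemma admissible_paths_eq_Union:
  assumes steps: "initial_steps i s = {(1, 1), (\<epsilon>, - \<epsilon>)}" and e: "height e = int H"
  defines "P \<equiv> \<lambda>t. (fst e - int t, int t - fst e)"
  shows "admissible_paths i s e = (\<Union>t\<le>H. initial_paths \<epsilon> s (P t) \<times> final_paths (P t) e)"
proof (rule subset_antisym; rule subsetI)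
  fix \<pi> assume "\<pi> \<in> admissible_paths i s e"
  then obtain p q Q where pq: "\<pi> = (p, q)" "height Q = 0" "p \<in> initial_paths \<epsilon> s Q" "q \<in> final_paths Q e"
    by (auto simp: admissible_paths_def steps initial_paths_def final_paths_def bounded_paths_def)
  have "lattice_path {(1, 0), (0, 1)} Q e q"
    using pq(4) by (auto simp: final_paths_def bounded_paths_def)
  moreover from this have "e \<in> set q"
    by (auto simp: lattice_path_def)
  ultimately have "fst Q \<le> fst e" "snd Q \<le> snd e"
    using final_path_bounds(3,5) by blast+
  with pq(2) e have "Q = P (nat (fst e - fst Q))" "nat (fst e - fst Q) \<le> H"
    by (auto simp: P_def height_def prod_eq_iff)
  with pq show "\<pi> \<in> (\<Union>t\<le>H. initial_paths \<epsilon> s (P t) \<times> final_paths (P t) e)"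
    by (intro UN_I[of "nat (fst e - fst Q)"]) auto
next
  fix \<pi> assume "\<pi> \<in> (\<Union>t\<le>H. initial_paths \<epsilon> s (P t) \<times> final_paths (P t) e)"
  then obtain t where t: "\<pi> \<in> initial_paths \<epsilon> s (P t) \<times> final_paths (P t) e"
    by blast
  have "height (P t) = 0"
    by (simp add: P_def height_def)
  with t show "\<pi> \<in> admissible_paths i s e"
    unfolding admissible_paths_def steps initial_paths_def final_paths_def bounded_paths_def
    by blast
qed

lemma degree_final_poly: "degree (final_poly c h m) \<le> m"
proof -
  have "degree (final_poly c h m) \<le> (\<Sum>t<m. degree [:1, c (h + int t):])"
    unfolding final_poly_def
    using degree_prod_sum_le[of "{..<m}" "\<lambda>t. [:1, c (h + int t):]"] by (simp add: comp_def)
  also have "\<dots> \<le> (\<Sum>t<m. 1)"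
    by (intro sum_mono) simp
  finally show ?thesis by simp
qed

lemma sum_admissible_paths:
  assumes eps: "\<epsilon> \<in> {1, -1}" and steps: "initial_steps i s = {(1, 1), (\<epsilon>, - \<epsilon>)}"
    and s: "height s = - 2 * int d" and e: "height e = int H"
  shows "finite (admissible_paths i s e)"
    and "(\<Sum>\<pi>\<in>admissible_paths i s e. path_weight X w j \<pi>) =
      (\<Sum>t\<le>H. coeff (final_poly (\<lambda>h. if h \<ge> int j - 1 then w else 1) 0 H) t *
         int_nth (level_fps X d) (\<epsilon> * (fst e - int t - fst s - int d)))"
proof -
  define P where "P t = (fst e - int t, int t - fst e)" for t
  note Un = admissible_paths_eq_Union[OF steps e, folded P_def]
  have hP: "height (P t) = 0" and fP: "fst (P t) = fst e - int t" for t
    by (simp_all add: P_def height_def)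
  note I = sum_initial_paths[OF eps s hP refl]
  have eP: "height e = height (P t) + int H" for t
    using e hP by simp
  note F = sum_final_paths[OF eP]
  have fin: "finite (initial_paths \<epsilon> s (P t) \<times> final_paths (P t) e)" for t
    by (intro finite_cartesian_product conjunct1[OF I] conjunct1[OF F])
  show "finite (admissible_paths i s e)"
    unfolding Un by (intro finite_UN_I finite_atMost fin)
  \<comment> \<open>The first vertex of the final list records t, so the pieces of the union are
    disjoint.\<close>
  have hd_eq: "hd q = P t" if "q \<in> final_paths (P t) e" for q t
    using that by (auto simp: final_paths_def bounded_paths_def lattice_path_def)
  have "(\<Sum>\<pi>\<in>admissible_paths i s e. path_weight X w j \<pi>) =
      (\<Sum>t\<le>H. \<Sum>\<pi>\<in>initial_paths \<epsilon> s (P t) \<times> final_paths (P t) e. path_weight X w j \<pi>)"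
    unfolding Un
  proof (rule sum.UNION_disjoint)
    show "\<forall>t\<in>{..H}. \<forall>t'\<in>{..H}. t \<noteq> t' \<longrightarrow>
        (initial_paths \<epsilon> s (P t) \<times> final_paths (P t) e) \<inter>
        (initial_paths \<epsilon> s (P t') \<times> final_paths (P t') e) = {}"
    proof (intro ballI impI)
      fix t t' :: nat assume "t \<noteq> t'"
      then have "P t \<noteq> P t'"
        by (simp add: P_def)
      then show "(initial_paths \<epsilon> s (P t) \<times> final_paths (P t) e) \<inter>
          (initial_paths \<epsilon> s (P t') \<times> final_paths (P t') e) = {}"
        using hd_eq[of _ t] hd_eq[of _ t'] by fastforce
    qed
  qed (use fin in auto)
  also have "\<dots> = (\<Sum>t\<le>H. (\<Sum>p\<in>initial_paths \<epsilon> s (P t). segment_weight X w j p) *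
      (\<Sum>q\<in>final_paths (P t) e. segment_weight X w j q))"
    by (simp add: sum_product sum.cartesian_product path_weight_def case_prod_unfold)
  also have "\<dots> = (\<Sum>t\<le>H. coeff (final_poly (\<lambda>h. if h \<ge> int j - 1 then w else 1) 0 H) t *
         int_nth (level_fps X d) (\<epsilon> * (fst e - int t - fst s - int d)))"
    by (intro sum.cong refl, subst conjunct2[OF I], subst conjunct2[OF F])
      (simp add: hP fP int_coeff_def mult.commute)
  finally show "(\<Sum>\<pi>\<in>admissible_paths i s e. path_weight X w j \<pi>) =
      (\<Sum>t\<le>H. coeff (final_poly (\<lambda>h. if h \<ge> int j - 1 then w else 1) 0 H) t *
         int_nth (level_fps X d) (\<epsilon> * (fst e - int t - fst s - int d)))" .
qed

section \<open>Path counts as coefficients of products of resolvents\<close>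

definition init_fps :: "(nat \<Rightarrow> 'a::field) \<Rightarrow> nat \<Rightarrow> 'a fps" where
  "init_fps X i = (\<Prod>s=1..i. resolvent (X s + inverse (X s)))"

lemma resolvent_eq_linear_factors:
  fixes x :: "'a::field"
  assumes "x \<noteq> 0"
  shows "resolvent (x + inverse x) = fps_X * inverse (1 - fps_const x * fps_X) *
    inverse (1 - fps_const (inverse x) * fps_X)"
proof -
  have "fps_const x * fps_const (inverse x) = 1"
    using assms by simp
  then have "1 - fps_const (x + inverse x) * fps_X + fps_X ^ 2 =
      (1 - fps_const x * fps_X) * (1 - fps_const (inverse x) * fps_X)"
    by (simp add: algebra_simps power2_eq_square flip: fps_const_add)
  then show ?thesis
    by (simp only: resolvent_def fps_inverse_mult mult.assoc)
qed

text \<open>Levels 2s - 2 and 2s - 1 carry X_s and its inverse, and their two geometric series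
  multiply to 1/(1 - v_s z + z^2). The starting points of index i lie on level 2i - 1, so levels 0
  to 2i - 1 form exactly i such pairs.\<close>

lemma init_fps_eq_level_fps:
  assumes "\<And>s. s \<in> {1..i} \<Longrightarrow> X s \<noteq> 0" and "i \<ge> 1"
  shows "init_fps X i = fps_X ^ i * level_fps X (2 * i - 1)"
  using assms(2,1)
proof (induction i rule: nat_induct_at_least)
  case base
  have "level_fps X 1 = inverse (1 - fps_const (X 1) * fps_X) * inverse (1 - fps_const (inverse (X 1)) * fps_X)"
    by (simp add: level_fps_def level_weight_def)
  moreover have "init_fps X 1 = resolvent (X 1 + inverse (X 1))"
    by (simp add: init_fps_def)
  ultimately show ?case
    using resolvent_eq_linear_factors[of "X 1"] base by (simp add: mult.assoc)
next
  case (Suc i)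
  let ?f = "\<lambda>c. inverse (1 - fps_const c * fps_X)"
  obtain m where m: "i = Suc m" using Suc.hyps by (cases i) auto
  have "2 * Suc i - 1 = Suc (Suc (2 * m + 1))" "2 * i - 1 = 2 * m + 1"
    by (simp_all add: m)
  then have "level_fps X (2 * Suc i - 1) = level_fps X (2 * i - 1) * ?f (X (Suc i)) * ?f (inverse (X (Suc i)))"
    by (simp only: level_fps_def prod.atMost_Suc) (simp add: level_weight_def m)
  moreover have "init_fps X (Suc i) = init_fps X i * resolvent (X (Suc i) + inverse (X (Suc i)))"
    by (simp add: init_fps_def)
  moreover have "init_fps X i = fps_X ^ i * level_fps X (2 * i - 1)"
    by (rule Suc.IH) (use Suc.prems in auto)
  moreover have "resolvent (X (Suc i) + inverse (X (Suc i))) = fps_X * ?f (X (Suc i)) * ?f (inverse (X (Suc i)))"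
    by (rule resolvent_eq_linear_factors) (use Suc.prems in auto)
  ultimately show ?case
    by (simp only: power_Suc mult_ac)
qed

lemma int_nth_X_power_mult: "int_nth (fps_X ^ i * f) x = int_nth (f :: 'a::field fps) (x - int i)"
  by (auto simp: int_nth_def fps_X_power_mult_nth nat_less_iff nat_diff_distrib)

text \<open>The minus sign is the share of a single path in (-1)^(number of starts at
  \<open>beta\<close>), which factors over the paths.\<close>

definition path_sum :: "(nat \<Rightarrow> 'a::field) \<Rightarrow> 'a \<Rightarrow> nat \<Rightarrow> nat \<Rightarrow> point \<Rightarrow> 'a" where
  "path_sum X w i j e = (\<Sum>\<pi>\<in>admissible_paths i (alpha i) e. path_weight X w j \<pi>)
     - (\<Sum>\<pi>\<in>admissible_paths i (beta i) e. path_weight X w j \<pi>)"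

lemma height_start:
  assumes "i \<ge> 1"
  shows "height (alpha i) = - 2 * int (2 * i - 1)" "height (beta i) = - 2 * int (2 * i - 1)"
  using assms by (auto simp: height_def alpha_def beta_def of_nat_diff)

lemma finite_admissible_paths:
  assumes "i \<ge> 1" "s \<in> {alpha i, beta i}" "height e \<ge> 0"
  shows "finite (admissible_paths i s e)"
proof -
  have e: "height e = int (nat (height e))" using assms by simp
  have "finite (admissible_paths i (alpha i) e)"
    by (rule sum_admissible_paths(1)[OF _ initial_steps_alpha height_start(1)[OF assms(1)] e]) simp
  moreover have "finite (admissible_paths i (beta i) e)"
    by (rule sum_admissible_paths(1)[OF _ initial_steps_beta[OF assms(1)] height_start(2)[OF assms(1)] e])
      simp
  ultimately show ?thesis
    using assms(2) by blast
qed

text \<open>Reflection in x = y exchanges the initial segments from \<open>alpha i\<close> and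
  \<open>beta i\<close> and negates x on the line x + y = 0. The two counts are therefore
  coefficients of the same series at -x and x.\<close>

lemma path_sum_eq:
  assumes "i \<ge> 1" "\<And>s. s \<in> {1..i} \<Longrightarrow> X s \<noteq> 0" "height e = int H"
  shows "path_sum X w i j e =
    (\<Sum>t\<le>H. coeff (final_poly (\<lambda>h. if h \<ge> int j - 1 then w else 1) 0 H) t *
      odd_nth (init_fps X i) (fst e - int t))"
proof -
  define c where "c t = coeff (final_poly (\<lambda>h. if h \<ge> int j - 1 then w else 1) 0 H) t" for t
  have F: "init_fps X i = fps_X ^ i * level_fps X (2 * i - 1)"
    by (rule init_fps_eq_level_fps) (use assms in auto)
  \<comment> \<open>The coordinates of the starting points leave a shift by i, which the factor z^i
    of \<open>init_fps\<close> absorbs.\<close>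
  have arg: "(-1) * (fst e - int t - fst (alpha i) - int (2 * i - 1)) = - (fst e - int t) - int i"
    "1 * (fst e - int t - fst (beta i) - int (2 * i - 1)) = (fst e - int t) - int i" for t
    using assms(1) by (auto simp: alpha_def beta_def of_nat_diff)
  have "(\<Sum>\<pi>\<in>admissible_paths i (alpha i) e. path_weight X w j \<pi>) =
      (\<Sum>t\<le>H. c t * int_nth (init_fps X i) (- (fst e - int t)))"
    by (subst sum_admissible_paths(2)[OF _ initial_steps_alpha height_start(1)[OF assms(1)] assms(3)])
      (simp, simp only: arg F int_nth_X_power_mult c_def)
  moreover have "(\<Sum>\<pi>\<in>admissible_paths i (beta i) e. path_weight X w j \<pi>) =
      (\<Sum>t\<le>H. c t * int_nth (init_fps X i) (fst e - int t))"
    by (subst sum_admissible_paths(2)[OF _ initial_steps_beta[OF assms(1)] height_start(2)[OF assms(1)]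
          assms(3)]) (simp, simp only: arg F int_nth_X_power_mult c_def)
  ultimately show ?thesis
    by (simp add: path_sum_def odd_nth_def right_diff_distrib sum_subtractf flip: c_def)
qed

lemma final_poly_add: "final_poly c h (a + b) = final_poly c h a * final_poly c (h + int a) b"
  by (induction a arbitrary: h)
    (simp_all add: final_poly_Suc mult.assoc add_ac final_poly_def[of _ _ 0] del: mult_pCons_left)

lemma final_poly_E':
  assumes "j \<ge> 1"
  shows "final_poly (\<lambda>h. if h \<ge> int j - 1 then w else 1) 0 (j - 1) = [:1, 1:] ^ (j - 1)"
proof -
  have "final_poly (\<lambda>h. if h \<ge> int j - 1 then w else 1) 0 (j - 1) = (\<Prod>t<j - 1. [:1, 1:])"
    unfolding final_poly_def using assms by (intro prod.cong) auto
  then show ?thesis by simp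
qed


text \<open>Of the n - 1 steps up to height n - 1, those starting at heights 0 to j - 2 have weight
  1 in either direction; only the last n - j can involve w.\<close>

lemma final_poly_E:
  assumes "j \<in> {1..n}"
  shows "final_poly (\<lambda>h. if h \<ge> int j - 1 then w else 1) 0 (n - 1) = [:1, 1:] ^ (j - 1) * [:1, w:] ^ (n - j)"
proof -
  have n: "n - 1 = (j - 1) + (n - j)" using assms by auto
  show ?thesis
    unfolding n final_poly_add using assms by (subst final_poly_E') (auto simp: final_poly_def)
qed

subsection \<open>The signed sum over all families\<close>

text \<open>For a fixed permutation the triples (start, endpoint, path) of different i are chosen
  independently, so the signed sum is a product of sums over single paths. This is the Leibniz
  expansion of a determinant.\<close>

lemma finite_families:
  assumes "\<And>j. j \<in> {1..n} \<Longrightarrow> finite (E j) \<and> (\<forall>e\<in>E j. height e \<ge> 0)"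
  shows "finite (families n E)"
    and sum_families: "(\<Sum>F\<in>families n E. of_int (family_sign n F) * family_weight X w n F) =
      Det n (\<lambda>i j. \<Sum>e\<in>E j. path_sum X w i j e)"
proof -
  define T where "T \<sigma> i = Sigma {alpha i, beta i} (\<lambda>s. Sigma (E (\<sigma> i)) (\<lambda>e. admissible_paths i s e))"
    for \<sigma> :: "nat \<Rightarrow> nat" and i
  define \<Omega> where "\<Omega> = Sigma {\<sigma>. \<sigma> permutes {1..n}} (\<lambda>\<sigma>. PiE {1..n} (T \<sigma>))"
  define mk where "mk = (\<lambda>(\<sigma>, g). \<lparr>perm = \<sigma>, start = (\<lambda>i\<in>{1..n}. fst (g i)),
    endpoint = (\<lambda>i\<in>{1..n}. fst (snd (g i))), paths = (\<lambda>i\<in>{1..n}. snd (snd (g i)))\<rparr>)"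
  define un where "un F = (perm F, \<lambda>i\<in>{1..n}. (start F i, endpoint F i, paths F i))" for F :: family
  have fin_T: "finite (T \<sigma> i)" if "\<sigma> permutes {1..n}" "i \<in> {1..n}" for \<sigma> i
  proof -
    have "\<sigma> i \<in> {1..n}" using that permutes_in_image by metis
    with assms that show ?thesis
      unfolding T_def by (intro finite_SigmaI finite_admissible_paths) auto
  qed
  have fin: "finite (PiE {1..n} (T \<sigma>))" if "\<sigma> permutes {1..n}" for \<sigma>
    using fin_T that by (intro finite_PiE) auto
  have fin_\<Omega>: "finite \<Omega>"
    unfolding \<Omega>_def using fin by (intro finite_SigmaI finite_permutations) auto
  \<comment> \<open>Families and choices of triples correspond one to one because all components are
    extensional outside {1..n}.\<close>
  have un_in: "un F \<in> \<Omega>" and mk_un: "mk (un F) = F" if "F \<in> families n E" for F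
  proof -
    show "un F \<in> \<Omega>"
      using that by (auto simp: un_def \<Omega>_def T_def families_def PiE_iff)
    show "mk (un F) = F"
      using that by (auto simp: un_def mk_def families_def PiE_iff extensional_def intro!: family.equality)
  qed
  have mk_in: "mk x \<in> families n E" and un_mk: "un (mk x) = x" if "x \<in> \<Omega>" for x
  proof -
    obtain \<sigma> g where x: "x = (\<sigma>, g)" by force
    have \<sigma>: "\<sigma> permutes {1..n}" and g: "\<And>i. i \<in> {1..n} \<Longrightarrow> g i \<in> T \<sigma> i" and ext: "g \<in> extensional {1..n}"
      using that by (auto simp: x \<Omega>_def PiE_iff)
    show "mk x \<in> families n E"
      using \<sigma> g by (force simp: x mk_def families_def T_def PiE_iff)
    show "un (mk x) = x"
      using ext by (auto simp: x un_def mk_def extensional_def)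
  qed
  have fam: "families n E = mk ` \<Omega>"
  proof (rule subset_antisym; rule subsetI)
    fix F assume "F \<in> families n E"
    then show "F \<in> mk ` \<Omega>"
      using un_in mk_un by (intro image_eqI[of F mk "un F"]) auto
  qed (use mk_in in auto)
  show "finite (families n E)"
    unfolding fam using fin_\<Omega> by simp
  \<comment> \<open>The sign of the starting points is moved into the single factors, so that the
    product of sums can be expanded.\<close>
  define sg :: "nat \<Rightarrow> point \<Rightarrow> int" where "sg i s = (if s = beta i then -1 else 1)" for i s
  define wt where "wt \<sigma> i = (\<lambda>(s, e :: point, \<pi>). of_int (sg i s) * path_weight X w (\<sigma> i) \<pi>)"
    for \<sigma> :: "nat \<Rightarrow> nat" and i
  have weight: "of_int (family_sign n (mk (\<sigma>, g))) * family_weight X w n (mk (\<sigma>, g)) =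
      of_int (sign \<sigma>) * (\<Prod>i=1..n. wt \<sigma> i (g i))" for \<sigma> g
  proof -
    have "(-1) ^ card {i \<in> {1..n}. fst (g i) = beta i} = (\<Prod>i=1..n. sg i (fst (g i)))"
      by (simp add: sg_def prod.If_cases Int_def)
    moreover have "{i \<in> {1..n}. start (mk (\<sigma>, g)) i = beta i} = {i \<in> {1..n}. fst (g i) = beta i}"
      by (auto simp: mk_def)
    ultimately have "family_sign n (mk (\<sigma>, g)) = sign \<sigma> * (\<Prod>i=1..n. sg i (fst (g i)))"
      by (simp add: family_sign_def) (simp add: mk_def)
    moreover have "family_weight X w n (mk (\<sigma>, g)) = (\<Prod>i=1..n. path_weight X w (\<sigma> i) (snd (snd (g i))))"
      by (simp add: family_weight_def mk_def)
    ultimately show ?thesis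
      by (simp add: wt_def case_prod_unfold prod.distrib)
  qed
  have inj: "inj_on mk \<Omega>"
    using un_mk by (intro inj_on_inverseI[of _ un])
  have entry: "(\<Sum>y\<in>T \<sigma> i. wt \<sigma> i y) = (\<Sum>e\<in>E (\<sigma> i). path_sum X w i (\<sigma> i) e)"
    if "\<sigma> permutes {1..n}" "i \<in> {1..n}" for \<sigma> i
  proof -
    have \<sigma>i: "\<sigma> i \<in> {1..n}" using that permutes_in_image by metis
    have ab: "alpha i \<noteq> beta i" using that alpha_neq_beta by simp
    have adm: "finite (admissible_paths i s e)" if "s \<in> {alpha i, beta i}" "e \<in> E (\<sigma> i)" for s e
      using that assms[OF \<sigma>i] \<open>i \<in> {1..n}\<close> by (intro finite_admissible_paths) auto
    have "(\<Sum>y\<in>T \<sigma> i. wt \<sigma> i y) = (\<Sum>s\<in>{alpha i, beta i}. \<Sum>e\<in>E (\<sigma> i). \<Sum>\<pi>\<in>admissible_paths i s e.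
        of_int (sg i s) * path_weight X w (\<sigma> i) \<pi>)"
      unfolding T_def wt_def using adm assms[OF \<sigma>i]
      by (simp add: sum.Sigma[symmetric] finite_SigmaI del: sum.insert)
    also have "\<dots> = (\<Sum>e\<in>E (\<sigma> i). path_sum X w i (\<sigma> i) e)"
      using ab by (simp add: sg_def path_sum_def sum_subtractf sum_negf)
    finally show ?thesis .
  qed
  have "(\<Sum>F\<in>families n E. of_int (family_sign n F) * family_weight X w n F) =
      (\<Sum>(\<sigma>, g)\<in>\<Omega>. of_int (sign \<sigma>) * (\<Prod>i=1..n. wt \<sigma> i (g i)))"
    unfolding fam by (subst sum.reindex[OF inj]) (auto simp: weight intro!: sum.cong)
  also have "\<dots> = (\<Sum>\<sigma> | \<sigma> permutes {1..n}. \<Sum>g\<in>PiE {1..n} (T \<sigma>).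
      of_int (sign \<sigma>) * (\<Prod>i=1..n. wt \<sigma> i (g i)))"
    unfolding \<Omega>_def by (rule sum.Sigma[symmetric]) (use fin in \<open>auto intro: finite_permutations\<close>)
  also have "\<dots> = (\<Sum>\<sigma> | \<sigma> permutes {1..n}. of_int (sign \<sigma>) *
      (\<Prod>i=1..n. \<Sum>y\<in>T \<sigma> i. wt \<sigma> i y))"
  proof (rule sum.cong[OF refl])
    fix \<sigma> assume "\<sigma> \<in> {\<sigma>. \<sigma> permutes {1..n}}"
    then show "(\<Sum>g\<in>PiE {1..n} (T \<sigma>). of_int (sign \<sigma>) * (\<Prod>i=1..n. wt \<sigma> i (g i))) =
        of_int (sign \<sigma>) * (\<Prod>i=1..n. \<Sum>y\<in>T \<sigma> i. wt \<sigma> i y)"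
      using fin_T by (subst prod_sum_PiE) (simp_all add: sum_distrib_left)
  qed
  also have "\<dots> = Det n (\<lambda>i j. \<Sum>e\<in>E j. path_sum X w i j e)"
    unfolding Det_def using entry by (intro sum.cong refl arg_cong2[where f = "(*)"] prod.cong) auto
  finally show "(\<Sum>F\<in>families n E. of_int (family_sign n F) * family_weight X w n F) =
      Det n (\<lambda>i j. \<Sum>e\<in>E j. path_sum X w i j e)" .
qed

section \<open>Matching the rows with those of the determinant in \<open>R\<close>\<close>

definition end_poly :: "'a::comm_ring_1 \<Rightarrow> nat \<Rightarrow> nat \<Rightarrow> 'a poly" where
  "end_poly w n j = [:1, 1:] ^ (j - 1) * [:1, w:] ^ (n - j)"

text \<open>A functional linear in \<open>f\<close>, so the Newton expansion passes through it. An
  endpoint enters only through its first coordinate \<open>x\<close>.\<close>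

definition end_sum :: "'a::field \<Rightarrow> nat \<Rightarrow> nat \<Rightarrow> 'a fps \<Rightarrow> int \<Rightarrow> 'a" where
  "end_sum w n j f x = (\<Sum>t\<le>n - 1. coeff (end_poly w n j) t * odd_nth f (x - int t))"

lemma degree_end_poly:
  assumes "j \<in> {1..n}"
  shows "degree (end_poly w n j) \<le> n - 1"
  using degree_final_poly[of "\<lambda>h. if h \<ge> int j - 1 then w else 1" 0 "n - 1"] final_poly_E[OF assms, of w]
  by (simp add: end_poly_def)

text \<open>Lowering an endpoint to height j - 1 keeps its first coordinate, and for w = 0 the
  factor (1 + w z)^(n - j) is 1. So the shortened endpoints give the same entries; the extra terms
  of the longer sum are zero.\<close>

lemma path_sum_eq_end_sum:
  assumes "i \<in> {1..n}" "j \<in> {1..n}" "\<And>s. s \<in> {1..n} \<Longrightarrow> X s \<noteq> 0"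
    and "height e = int n - 1 \<or> w = 0 \<and> height e = int j - 1"
  shows "path_sum X w i j e = end_sum w n j (init_fps X i) (fst e)"
  using assms(4)
proof (elim disjE conjE)
  assume "height e = int n - 1"
  with assms(1) have "height e = int (n - 1)" by auto
  then show ?thesis
    using assms path_sum_eq[of i X e "n - 1" w j] final_poly_E[OF assms(2), of w]
    by (simp add: end_sum_def end_poly_def)
next
  assume w: "w = 0" and "height e = int j - 1"
  with assms(2) have "height e = int (j - 1)" by auto
  then have "path_sum X w i j e = (\<Sum>t\<le>j - 1. coeff (end_poly w n j) t * odd_nth (init_fps X i) (fst e - int t))"
    using assms path_sum_eq[of i X e "j - 1" w j] final_poly_E'[of j w]
    by (simp add: end_poly_def w flip: one_pCons)
  also have "\<dots> = (\<Sum>t\<le>n - 1. coeff (end_poly w n j) t * odd_nth (init_fps X i) (fst e - int t))"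
  proof (rule sum.mono_neutral_left)
    have "degree (end_poly w n j) \<le> j - 1"
      using degree_final_poly[of "\<lambda>h. if h \<ge> int j - 1 then w else 1" 0 "j - 1"] final_poly_E'[of j w] assms(2)
      by (simp add: end_poly_def w flip: one_pCons)
    then show "\<forall>t\<in>{..n - 1} - {..j - 1}. coeff (end_poly w n j) t * odd_nth (init_fps X i) (fst e - int t) = 0"
      by (auto simp: coeff_eq_0)
  qed (use assms(2) in auto)
  finally show ?thesis by (simp add: end_sum_def)
qed

lemma end_sum_newton:
  fixes X :: "nat \<Rightarrow> 'a::field"
  assumes "r \<ge> 1"
  defines "v \<equiv> \<lambda>i. X i + inverse (X i)"
  shows "end_sum w n j (resolvent (v r)) x = (\<Sum>i=1..r. (\<Prod>s\<in>{1..<i}. v r - v s) * end_sum w n j (init_fps X i) x)"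
proof -
  have F: "init_fps X i = (\<Prod>s=1..i. resolvent (v s))" for i
    by (simp add: init_fps_def v_def)
  have "odd_nth (resolvent (v r)) y = (\<Sum>i=1..r. (\<Prod>s\<in>{1..<i}. v r - v s) * odd_nth (init_fps X i) y)" for y
    by (subst resolvent_newton[OF assms(1), of v], subst odd_nth_sum) (simp_all only: odd_nth_const_mult F finite_atLeastAtMost)
  then have "end_sum w n j (resolvent (v r)) x = (\<Sum>t\<le>n - 1. \<Sum>i=1..r. (\<Prod>s\<in>{1..<i}. v r - v s) *
      (coeff (end_poly w n j) t * odd_nth (init_fps X i) (x - int t)))"
    by (simp add: end_sum_def sum_distrib_left mult_ac)
  then show ?thesis
    unfolding end_sum_def sum_distrib_left by (subst sum.swap) simp
qed

text \<open>After multiplication by x - 1/x, or by x - 1 for two neighbouring endpoints, the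
  coefficients of the resolvent are differences of powers of x. Summing them against
  \<open>end_poly\<close> evaluates this polynomial at x and 1/x.\<close>

lemma end_sum_resolvent:
  fixes x :: "'a::field"
  assumes "x \<noteq> 0" "j \<in> {1..n}"
  shows "(x - inverse x) * end_sum w n j (resolvent (x + inverse x)) T =
      x powi (- T) * poly (end_poly w n j) x - x powi T * poly (end_poly w n j) (inverse x)"
    and "(x - 1) * (end_sum w n j (resolvent (x + inverse x)) T + end_sum w n j (resolvent (x + inverse x)) (T - 1)) =
      x powi (1 - T) * poly (end_poly w n j) x - x powi T * poly (end_poly w n j) (inverse x)"
proof -
  let ?c = "coeff (end_poly w n j)" and ?o = "odd_nth (resolvent (x + inverse x))"
  note powi = sum_coeff_powi[OF assms(1) degree_end_poly[OF assms(2)], symmetric]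
  have "(x - inverse x) * end_sum w n j (resolvent (x + inverse x)) T =
      (\<Sum>t\<le>n - 1. ?c t * ((x - inverse x) * ?o (T - int t)))"
    by (simp add: end_sum_def sum_distrib_left mult_ac)
  also have "\<dots> = (\<Sum>t\<le>n - 1. ?c t * x powi (- T + int t)) - (\<Sum>t\<le>n - 1. ?c t * x powi (T - int t))"
    unfolding odd_nth_resolvent[OF assms(1)] by (simp add: right_diff_distrib sum_subtractf)
  finally show "(x - inverse x) * end_sum w n j (resolvent (x + inverse x)) T =
      x powi (- T) * poly (end_poly w n j) x - x powi T * poly (end_poly w n j) (inverse x)"
    by (simp only: powi)
  have "(x - 1) * (end_sum w n j (resolvent (x + inverse x)) T + end_sum w n j (resolvent (x + inverse x)) (T - 1)) =
      (\<Sum>t\<le>n - 1. ?c t * ((x - 1) * (?o (T - int t) + ?o (T - int t - 1))))"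
    unfolding end_sum_def sum_distrib_left sum.distrib[symmetric]
    by (intro sum.cong refl) (simp add: algebra_simps)
  also have "\<dots> = (\<Sum>t\<le>n - 1. ?c t * x powi (1 - T + int t)) - (\<Sum>t\<le>n - 1. ?c t * x powi (T - int t))"
    unfolding odd_nth_resolvent_pair[OF assms(1)] by (simp add: right_diff_distrib sum_subtractf algebra_simps)
  finally show "(x - 1) * (end_sum w n j (resolvent (x + inverse x)) T + end_sum w n j (resolvent (x + inverse x)) (T - 1)) =
      x powi (1 - T) * poly (end_poly w n j) x - x powi T * poly (end_poly w n j) (inverse x)"
    by (simp only: powi)
qed

text \<open>The power of X_i is chosen so that the two terms, which carry opposite powers x^(-T) and
  x^T, acquire the exponents j - 1 and m + 2n - j of \<open>R_entry\<close>. \<open>T\<close> is the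
  first coordinate of the endpoint.\<close>

lemma R_entry_eq:
  fixes X :: "nat \<Rightarrow> 'a::field" and l :: nat
  assumes "X i \<noteq> 0" "j \<in> {1..n}"
  defines "T \<equiv> int n - int j + int l + 1" and "g \<equiv> resolvent (X i + inverse (X i))"
  shows "R_entry X w n (2 * l + 1) i j =
      X i ^ (n + l - 1) * ((X i - 1) * (1 + X i)) * end_sum w n j g T"
    and "R_entry X w n (2 * l) i j =
      X i ^ (n + l - 1) * (X i - 1) * (end_sum w n j g T + end_sum w n j g (T - 1))"
proof -
  let ?x = "X i" and ?c = "end_poly w n j"
  have pw: "?x ^ a * ?x powi b = ?x ^ c" if "int a + b = int c" for a b c
    using assms(1) that by (metis power_int_add power_int_of_nat)
  have c: "poly ?c y = (1 + y) ^ (j - 1) * (1 + w * y) ^ (n - j)" for y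
    by (simp add: end_poly_def mult.commute)
  \<comment> \<open>One factor x is spent on x (x - 1/x) = (x - 1)(1 + x).\<close>
  have "?x ^ (n + l - 1) * ((?x - 1) * (1 + ?x)) = ?x ^ (n + l) * (?x - inverse ?x)"
    using assms(1,2) by (cases "n + l") (auto simp: field_simps)
  then have "?x ^ (n + l - 1) * ((?x - 1) * (1 + ?x)) * end_sum w n j g T =
      ?x ^ (n + l) * ?x powi (- T) * poly ?c ?x - ?x ^ (n + l) * ?x powi T * poly ?c (inverse ?x)"
    using end_sum_resolvent(1)[OF assms(1,2), of w T]
    by (simp only: mult.assoc g_def) (simp add: right_diff_distrib mult.assoc)
  also have "?x ^ (n + l) * ?x powi (- T) = ?x ^ (j - 1)"
    using assms(2) by (intro pw) (auto simp: T_def)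
  also have "?x ^ (n + l) * ?x powi T = ?x ^ (2 * l + 1 + 2 * n - j)"
    using assms(2) by (intro pw) (auto simp: T_def)
  finally show "R_entry X w n (2 * l + 1) i j =
      X i ^ (n + l - 1) * ((X i - 1) * (1 + X i)) * end_sum w n j g T"
    by (simp add: R_entry_def c mult.assoc)
  have "?x ^ (n + l - 1) * (?x - 1) * (end_sum w n j g T + end_sum w n j g (T - 1)) =
      ?x ^ (n + l - 1) * ?x powi (1 - T) * poly ?c ?x - ?x ^ (n + l - 1) * ?x powi T * poly ?c (inverse ?x)"
    using end_sum_resolvent(2)[OF assms(1,2), of w T]
    by (simp only: mult.assoc g_def) (simp add: right_diff_distrib mult.assoc)
  also have "?x ^ (n + l - 1) * ?x powi (1 - T) = ?x ^ (j - 1)"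
    using assms(2) by (intro pw) (auto simp: T_def)
  also have "?x ^ (n + l - 1) * ?x powi T = ?x ^ (2 * l + 2 * n - j)"
    using assms(2) by (intro pw) (auto simp: T_def)
  finally show "R_entry X w n (2 * l) i j =
      X i ^ (n + l - 1) * (X i - 1) * (end_sum w n j g T + end_sum w n j g (T - 1))"
    by (simp add: R_entry_def c mult.assoc)
qed

lemma prod_pairs_mult:
  fixes y :: "nat \<Rightarrow> 'a::comm_semiring_1"
  shows "(\<Prod>j=1..n. \<Prod>i\<in>{1..<j}. y i * y j) = (\<Prod>i=1..n. y i ^ (n - 1))"
proof (induction n)
  case (Suc n)
  have step: "(\<Prod>j=1..Suc n. g j) = (\<Prod>j=1..n. g j) * g (Suc n)" for g :: "nat \<Rightarrow> 'a"
    by simp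
  have "(\<Prod>i=1..n. y i ^ n) = (\<Prod>i=1..n. y i ^ (n - 1)) * (\<Prod>i=1..n. y i)"
    by (cases n) (simp_all add: prod.distrib mult_ac)
  moreover have "(\<Prod>i\<in>{1..<Suc n}. y i * y (Suc n)) = (\<Prod>i=1..n. y i) * y (Suc n) ^ n"
    unfolding atLeastLessThanSuc_atLeastAtMost by (simp add: prod.distrib)
  ultimately show ?case
    unfolding step Suc by (simp add: mult.assoc)
qed simp

lemma prod_pairs_minus_one:
  "(\<Prod>j=1..n. \<Prod>i\<in>{1..<j}. -1) = ((-1) ^ (n choose 2) :: 'a::comm_ring_1)"
proof (induction n)
  case (Suc n)
  have "Suc n choose 2 = (n choose 2) + n"
    by (simp add: numeral_2_eq_2)
  moreover have "(\<Prod>j=1..Suc n. g j) = (\<Prod>j=1..n. g j) * g (Suc n)" for g :: "nat \<Rightarrow> 'a"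
    by simp
  ultimately show ?case
    by (simp only: Suc power_add) simp
qed (simp add: numeral_2_eq_2)

lemma prod_pairs_swap:
  fixes n :: nat
  shows "(\<Prod>i=1..n. \<Prod>j=i+1..n. f i j) = (\<Prod>j=1..n. \<Prod>i\<in>{1..<j}. f i j)"
proof -
  have "(\<Prod>(i, j)\<in>Sigma {1..n} (\<lambda>i. {i+1..n}). f i j) = (\<Prod>(j, i)\<in>Sigma {1..n} (\<lambda>j. {1..<j}). f i j)"
    by (rule prod.reindex_bij_witness[of _ prod.swap prod.swap]) auto
  then show ?thesis
    by (simp add: prod.Sigma)
qed

text \<open>X_i X_j (v_j - v_i) = -(1 - X_i X_j)(X_j - X_i), and each index occurs in n - 1 pairs.
  Thus the Newton diagonal is the denominator of \<open>R\<close> up to sign and powers of the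
  X_i.\<close>

lemma prod_diff_plus_inverse:
  fixes X :: "nat \<Rightarrow> 'a::field"
  assumes "\<And>i. i \<in> {1..n} \<Longrightarrow> X i \<noteq> 0"
  defines "v \<equiv> \<lambda>i. X i + inverse (X i)"
  shows "(\<Prod>i=1..n. X i ^ (n - 1)) * (\<Prod>j=1..n. \<Prod>i\<in>{1..<j}. v j - v i) =
    (-1) ^ (n choose 2) * (\<Prod>i=1..n. \<Prod>j=i+1..n. (1 - X i * X j) * (X j - X i))"
proof -
  have "(\<Prod>i=1..n. X i ^ (n - 1)) * (\<Prod>j=1..n. \<Prod>i\<in>{1..<j}. v j - v i) =
      (\<Prod>j=1..n. \<Prod>i\<in>{1..<j}. X i * X j * (v j - v i))"
    by (simp only: prod.distrib prod_pairs_mult[symmetric])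
  also have "\<dots> = (\<Prod>j=1..n. \<Prod>i\<in>{1..<j}. -1 * ((1 - X i * X j) * (X j - X i)))"
    using assms(1) by (intro prod.cong refl) (auto simp: v_def field_simps)
  also have "\<dots> = (-1) ^ (n choose 2) * (\<Prod>j=1..n. \<Prod>i\<in>{1..<j}. (1 - X i * X j) * (X j - X i))"
    by (simp only: prod.distrib prod_pairs_minus_one)
  finally show ?thesis
    by (simp only: prod_pairs_swap)
qed

text \<open>\<open>A j\<close> holds the first coordinates of the j-th endpoints, and \<rho> is what
  distinguishes the two parities of m. The sign combines (-1)^n from X_i - 1 = -(1 - X_i) with one
  sign for each pair i < j.\<close>

lemma R_eq_Det:
  fixes X :: "nat \<Rightarrow> 'a::field" and \<rho> :: "nat \<Rightarrow> 'a"
  assumes "n \<ge> 1" and gen: "generic n X"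
    and entry: "\<And>i j. i \<in> {1..n} \<Longrightarrow> j \<in> {1..n} \<Longrightarrow> R_entry X w n m i j =
      X i ^ (n + l - 1) * ((X i - 1) * \<rho> i) * (\<Sum>x\<in>A j. end_sum w n j (resolvent (X i + inverse (X i))) x)"
  shows "R X w n m = (-1) ^ ((n + 1) choose 2) * (\<Prod>i=1..n. X i ^ l * (inverse (X i) + 1 + w + X i) * \<rho> i) *
    Det n (\<lambda>i j. \<Sum>x\<in>A j. end_sum w n j (init_fps X i) x)"
proof -
  define v where "v i = X i + inverse (X i)" for i
  define N where "N i j = (\<Sum>x\<in>A j. end_sum w n j (resolvent (v i)) x)" for i j
  define M where "M i j = (\<Sum>x\<in>A j. end_sum w n j (init_fps X i) x)" for i j
  define D where "D = (\<Prod>i=1..n. \<Prod>j=i+1..n. (1 - X i * X j) * (X j - X i))"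
  have X: "X i \<noteq> 0" "X i \<noteq> 1" if "i \<in> {1..n}" for i
    using gen that by (auto simp: generic_def)
  have D0: "D \<noteq> 0"
  proof -
    have "(1 - X i * X j) * (X j - X i) \<noteq> 0" if "i \<in> {1..n}" "j \<in> {i+1..n}" for i j
    proof -
      have "i < j" "j \<in> {1..n}" using that by auto
      with gen that(1) have "X i * X j \<noteq> 1 \<and> X i \<noteq> X j"
        unfolding generic_def by blast
      then show ?thesis by auto
    qed
    then show ?thesis
      unfolding D_def by (simp only: prod_zero_iff finite_atLeastAtMost) blast
  qed
  have Q0: "(\<Prod>i=1..n. 1 - X i) \<noteq> 0"
    using X by auto
  have "Det n N = (\<Prod>i=1..n. \<Prod>s\<in>{1..<i}. v i - v s) * Det n M"
  proof (rule Det_lower_triangular_mult[where b = "\<lambda>i k. \<Prod>s\<in>{1..<k}. v i - v s"])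
    fix i j assume ij: "i \<in> {1..n}" "j \<in> {1..n}"
    have "N i j = (\<Sum>x\<in>A j. \<Sum>k=1..i. (\<Prod>s\<in>{1..<k}. v i - v s) * end_sum w n j (init_fps X k) x)"
      unfolding N_def v_def using ij by (intro sum.cong refl end_sum_newton) auto
    also have "\<dots> = (\<Sum>k=1..i. (\<Prod>s\<in>{1..<k}. v i - v s) * M k j)"
      unfolding M_def sum_distrib_left by (rule sum.swap)
    finally show "N i j = (\<Sum>k=1..i. (\<Prod>s\<in>{1..<k}. v i - v s) * M k j)" .
  qed
  moreover have "Det n (R_entry X w n m) = (\<Prod>i=1..n. X i ^ (n + l - 1) * ((X i - 1) * \<rho> i)) * Det n N"
    unfolding Det_scale_rows[symmetric] by (intro Det_cong) (simp add: entry N_def v_def)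
  \<comment> \<open>The power splits: X_i^l stays in the prefactor, while X_i^(n - 1) clears the
    inverses in the differences v_j - v_i.\<close>
  moreover have "(\<Prod>i=1..n. X i ^ (n + l - 1) * ((X i - 1) * \<rho> i)) =
      (-1) ^ n * (\<Prod>i=1..n. 1 - X i) * (\<Prod>i=1..n. X i ^ l * \<rho> i) * (\<Prod>i=1..n. X i ^ (n - 1))"
  proof -
    have "X i ^ (n + l - 1) * ((X i - 1) * \<rho> i) = -1 * (1 - X i) * (X i ^ l * \<rho> i) * X i ^ (n - 1)" for i
      using assms(1) by (cases n) (auto simp: power_add algebra_simps)
    moreover have "(\<Prod>i=1..n. -1 :: 'a) = (-1) ^ n" by simp
    ultimately show ?thesis by (simp only: prod.distrib)
  qed
  ultimately have "Det n (R_entry X w n m) = (-1) ^ n * (\<Prod>i=1..n. 1 - X i) * (\<Prod>i=1..n. X i ^ l * \<rho> i) *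
      ((\<Prod>i=1..n. X i ^ (n - 1)) * (\<Prod>i=1..n. \<Prod>s\<in>{1..<i}. v i - v s)) * Det n M"
    by (simp only: mult_ac)
  also have "\<dots> = ((-1) ^ n * (-1) ^ (n choose 2)) * (\<Prod>i=1..n. X i ^ l * \<rho> i) * Det n M *
      ((\<Prod>i=1..n. 1 - X i) * D)"
  proof -
    have "(\<Prod>i=1..n. X i ^ (n - 1)) * (\<Prod>i=1..n. \<Prod>s\<in>{1..<i}. v i - v s) = (-1) ^ (n choose 2) * D"
      unfolding v_def D_def using X by (intro prod_diff_plus_inverse)
    then show ?thesis by (simp only: mult_ac)
  qed
  also have "(-1) ^ n * (-1) ^ (n choose 2) = ((-1) ^ ((n + 1) choose 2) :: 'a)"
    by (simp add: numeral_2_eq_2 power_add)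
  finally have "det (mat n n (\<lambda>(i, j). R_entry X w n m (i + 1) (j + 1))) / ((\<Prod>i=1..n. 1 - X i) * D) =
      (-1) ^ ((n + 1) choose 2) * (\<Prod>i=1..n. X i ^ l * \<rho> i) * Det n M"
    unfolding Det_eq_det[symmetric] using D0 Q0 by (intro nonzero_divide_eq_eq[THEN iffD2]) auto
  then show ?thesis
    unfolding R_def D_def[symmetric] M_def[symmetric] by (simp only: prod.distrib mult_ac)
qed

subsection \<open>Exchanging tails\<close>

text \<open>Pairing the positive with the negative terms, instead of deriving \<open>S = - S\<close>, covers characteristic 2.\<close>

lemma sum_sign_reversing_involution:
  fixes g :: "'b \<Rightarrow> 'a::comm_ring_1" and sg :: "'b \<Rightarrow> int"
  assumes "finite A" and closed: "\<And>x. x \<in> A \<Longrightarrow> f x \<in> A" and inv: "\<And>x. x \<in> A \<Longrightarrow> f (f x) = x"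
    and sg: "\<And>x. x \<in> A \<Longrightarrow> sg x \<in> {1, -1}" and sgf: "\<And>x. x \<in> A \<Longrightarrow> sg (f x) = - sg x"
    and g: "\<And>x. x \<in> A \<Longrightarrow> g (f x) = g x"
  shows "(\<Sum>x\<in>A. of_int (sg x) * g x) = 0"
proof -
  let ?P = "{x \<in> A. sg x = 1}" and ?N = "{x \<in> A. sg x = -1}"
  have "A = ?P \<union> ?N" "?P \<inter> ?N = {}"
    using sg by auto
  then have "(\<Sum>x\<in>A. of_int (sg x) * g x) = (\<Sum>x\<in>?P. of_int (sg x) * g x) + (\<Sum>x\<in>?N. of_int (sg x) * g x)"
    using assms(1) by (metis (no_types, lifting) finite_Un sum.union_disjoint)
  also have "\<dots> = (\<Sum>x\<in>?P. g x) - (\<Sum>x\<in>?N. g x)"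
    by (simp add: sum_negf)
  also have "(\<Sum>x\<in>?P. g x) = (\<Sum>x\<in>?N. g x)"
    by (rule sum.reindex_bij_witness[of _ f f]) (auto simp: closed inv sgf g)
  finally show ?thesis by simp
qed

text \<open>The cut is at the first occurrence of \<open>v\<close>, which stays the first one after
  splicing, so splicing twice restores the lists. If \<open>v\<close> lies in neither list the
  result is \<open>p\<close>.\<close>

definition splice_at :: "'v \<Rightarrow> 'v list \<Rightarrow> 'v list \<Rightarrow> 'v list" where
  "splice_at v p q = takeWhile (\<lambda>u. u \<noteq> v) p @ dropWhile (\<lambda>u. u \<noteq> v) q"

lemma splice_at_self [simp]: "splice_at v p p = p"
  by (simp add: splice_at_def)

lemma takeWhile_neq_split: "v \<notin> set a \<Longrightarrow> takeWhile (\<lambda>u. u \<noteq> v) (a @ v # b) = a"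
  and dropWhile_neq_split: "v \<notin> set a \<Longrightarrow> dropWhile (\<lambda>u. u \<noteq> v) (a @ v # b) = v # b"
  by (induction a) auto

lemma splice_at_split: "v \<notin> set a \<Longrightarrow> v \<notin> set a' \<Longrightarrow> splice_at v (a @ v # b) (a' @ v # b') = a @ v # b'"
  by (simp add: splice_at_def takeWhile_neq_split dropWhile_neq_split)

lemma splice_at_in:
  assumes "v \<in> set q"
  shows "v \<in> set (splice_at v p q)"
proof -
  obtain a b where q: "q = a @ v # b" "v \<notin> set a"
    using assms split_list_first by metis
  then have "dropWhile (\<lambda>u. u \<noteq> v) q = v # b"
    by (simp add: dropWhile_neq_split)
  then show ?thesis by (simp add: splice_at_def)
qed

lemma set_splice_at: "set (splice_at v p q) \<subseteq> set p \<union> set q"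
  by (auto simp: splice_at_def dest: set_takeWhileD set_dropWhileD)

lemma splice_at_twice:
  assumes "v \<in> set p \<longleftrightarrow> v \<in> set q"
  shows "splice_at v (splice_at v p q) (splice_at v q p) = p"
proof (cases "v \<in> set p")
  case True
  with assms obtain a b a' b' where "p = a @ v # b" "v \<notin> set a" "q = a' @ v # b'" "v \<notin> set a'"
    using split_list_first by metis
  then show ?thesis by (simp add: splice_at_split)
next
  case False
  have p: "takeWhile (\<lambda>u. u \<noteq> v) p = p" "takeWhile (\<lambda>u. u \<noteq> v) q = q"
      "dropWhile (\<lambda>u. u \<noteq> v) p = []" "dropWhile (\<lambda>u. u \<noteq> v) q = []"
    using False assms by (auto simp: takeWhile_eq_all_conv)
  have "splice_at v p q = p" "splice_at v q p = q"
    by (simp_all add: splice_at_def p del: takeWhile_eq_all_conv dropWhile_eq_Nil_conv)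
  then show ?thesis by (simp add: splice_at_def p del: takeWhile_eq_all_conv dropWhile_eq_Nil_conv)
qed

lemma mset_splice_at:
  "mset (splice_at v p q) = mset (takeWhile (\<lambda>u. u \<noteq> v) p) + mset (dropWhile (\<lambda>u. u \<noteq> v) q)"
  by (simp add: splice_at_def)

lemma lattice_path_append:
  "lattice_path S a b (p @ v # q) \<longleftrightarrow> lattice_path S a v (p @ [v]) \<and> lattice_path S v b (v # q)"
proof (induction p arbitrary: a)
  case Nil
  then show ?case by (auto simp: lattice_path_def)
next
  case (Cons u p)
  then show ?case by (auto simp: lattice_path_Cons)
qed

lemma lattice_path_splice_at:
  assumes "lattice_path S a b p" "lattice_path S a' b' q" "v \<in> set p" "v \<in> set q"
  shows "lattice_path S a b' (splice_at v p q)"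
proof -
  obtain c d c' d' where "p = c @ v # d" "v \<notin> set c" "q = c' @ v # d'" "v \<notin> set c'"
    using assms(3,4) split_list_first by metis
  with assms show ?thesis
    by (simp add: splice_at_split) (metis lattice_path_append)
qed

lemma segment_weight_append:
  "segment_weight X w j (p @ v # q) = segment_weight X w j (p @ [v]) * segment_weight X w j (v # q)"
proof (induction p)
  case (Cons u p)
  then show ?case
    by (cases p) (auto simp: segment_weight_Cons mult_ac)
qed simp

definition common :: "nat \<Rightarrow> (nat \<Rightarrow> 'v list) \<Rightarrow> 'v set" where
  "common n L = {v. \<exists>i\<in>{1..n}. \<exists>j\<in>{1..n}. i \<noteq> j \<and> v \<in> set (L i) \<and> v \<in> set (L j)}"

text \<open>The choice depends only on the set of common vertices, which an exchange of tails preserves;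
  hence the exchange is an involution.\<close>

definition crossing :: "nat \<Rightarrow> (nat \<Rightarrow> 'v list) \<Rightarrow> 'v" where
  "crossing n L = (SOME v. v \<in> common n L)"

definition through :: "nat \<Rightarrow> (nat \<Rightarrow> 'v list) \<Rightarrow> nat set" where
  "through n L = {i \<in> {1..n}. crossing n L \<in> set (L i)}"

text \<open>More than two paths may run through the crossing. Taking the two least indices depends
  only on the set of these paths, which an exchange of tails does not change.\<close>

definition exchange :: "nat \<Rightarrow> (nat \<Rightarrow> 'v list) \<Rightarrow> nat \<Rightarrow> nat" where
  "exchange n L = transpose (Min (through n L)) (Min (through n L - {Min (through n L)}))"

definition swap_tails :: "nat \<Rightarrow> (nat \<Rightarrow> 'v list) \<Rightarrow> nat \<Rightarrow> 'v list" where
  "swap_tails n L k = splice_at (crossing n L) (L k) (L (exchange n L k))"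

lemma common_cong: "(\<And>k. k \<in> {1..n} \<Longrightarrow> L k = L' k) \<Longrightarrow> common n L = common n L'"
  unfolding common_def by auto

lemma exchange_cong:
  assumes "common n L = common n L'"
    and "\<And>k. k \<in> {1..n} \<Longrightarrow> crossing n L \<in> set (L k) \<longleftrightarrow> crossing n L \<in> set (L' k)"
  shows "crossing n L = crossing n L'" "exchange n L = exchange n L'"
proof -
  show c: "crossing n L = crossing n L'"
    by (simp add: crossing_def assms(1))
  have "through n L = through n L'"
    using assms(2) by (auto simp: through_def c)
  then show "exchange n L = exchange n L'"
    by (simp add: exchange_def)
qed

lemma exchange:
  assumes "common n L \<noteq> {}"
  obtains i j where "exchange n L = transpose i j" "i \<noteq> j" "i \<in> {1..n}" "j \<in> {1..n}"
    "crossing n L \<in> set (L i)" "crossing n L \<in> set (L j)"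
proof -
  let ?T = "through n L"
  have "crossing n L \<in> common n L"
    unfolding crossing_def using assms by (simp add: some_in_eq)
  then obtain a b where ab: "a \<noteq> b" "a \<in> ?T" "b \<in> ?T"
    by (auto simp: common_def through_def)
  have fin: "finite ?T" by (simp add: through_def)
  have "?T \<noteq> {}" using ab by auto
  then have 1: "Min ?T \<in> ?T" using fin by simp
  have "?T - {Min ?T} \<noteq> {}" using ab by auto
  then have 2: "Min (?T - {Min ?T}) \<in> ?T - {Min ?T}" using fin by (intro Min_in) auto
  show ?thesis
    using that[of "Min ?T" "Min (?T - {Min ?T})"] 1 2 by (auto simp: exchange_def through_def)
qed

context
  fixes n :: nat and L :: "nat \<Rightarrow> 'v list"
  assumes ne: "common n L \<noteq> {}"
begin

lemma exchange_permutes: "exchange n L permutes {1..n}"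
  using ne by (rule exchange) (simp add: permutes_swap_id)

lemma exchange_in: "k \<in> {1..n} \<Longrightarrow> exchange n L k \<in> {1..n}"
  using exchange_permutes permutes_in_image by metis

lemma sign_exchange: "sign (exchange n L) = -1"
  using ne by (rule exchange) (simp add: sign_swap_id)

lemma exchange_exchange: "exchange n L (exchange n L k) = k"
  using ne by (rule exchange) simp

lemma exchange_cases:
  "exchange n L k = k \<or> crossing n L \<in> set (L k) \<and> crossing n L \<in> set (L (exchange n L k))"
  using ne by (rule exchange) (auto simp: transpose_def)

lemma crossing_exchange: "crossing n L \<in> set (L (exchange n L k)) \<longleftrightarrow> crossing n L \<in> set (L k)"
  using exchange_cases[of k] by auto

lemma crossing_swap_tails: "crossing n L \<in> set (swap_tails n L k) \<longleftrightarrow> crossing n L \<in> set (L k)"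
  using exchange_cases[of k] by (auto simp: swap_tails_def intro: splice_at_in)

text \<open>An exchange of tails preserves the multiset union of all vertices, and for lists without
  repetitions a vertex is common iff its multiplicity there is at least 2.\<close>

lemma common_swap_tails:
  assumes "\<And>k. k \<in> {1..n} \<Longrightarrow> distinct (L k)" "\<And>k. k \<in> {1..n} \<Longrightarrow> distinct (swap_tails n L k)"
  shows "common n (swap_tails n L) = common n L"
proof -
  have common_iff: "v \<in> common n K \<longleftrightarrow> count (\<Sum>k=1..n. mset (K k)) v \<ge> 2"
    if "\<And>k. k \<in> {1..n} \<Longrightarrow> distinct (K k)" for K :: "nat \<Rightarrow> 'v list" and v
  proof -
    have "count (\<Sum>k=1..n. mset (K k)) v = (\<Sum>k=1..n. if v \<in> set (K k) then 1 else 0)"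
      unfolding count_sum using that by (intro sum.cong) (auto simp: distinct_count_atmost_1)
    also have "\<dots> = card {k \<in> {1..n}. v \<in> set (K k)}"
      by (simp add: sum.If_cases Int_def)
    finally have "count (\<Sum>k=1..n. mset (K k)) v \<ge> 2 \<longleftrightarrow> \<not> card {k \<in> {1..n}. v \<in> set (K k)} \<le> Suc 0"
      by linarith
    also have "\<dots> \<longleftrightarrow> v \<in> common n K"
      unfolding common_def by (subst card_le_Suc0_iff_eq) (simp, blast)
    finally show ?thesis ..
  qed
  let ?v = "crossing n L"
  have "(\<Sum>k=1..n. mset (swap_tails n L k)) = (\<Sum>k=1..n. mset (takeWhile (\<lambda>u. u \<noteq> ?v) (L k))) +
      (\<Sum>k=1..n. mset (dropWhile (\<lambda>u. u \<noteq> ?v) (L (exchange n L k))))"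
    by (simp add: swap_tails_def mset_splice_at sum.distrib)
  also have "(\<Sum>k=1..n. mset (dropWhile (\<lambda>u. u \<noteq> ?v) (L (exchange n L k)))) =
      (\<Sum>k=1..n. mset (dropWhile (\<lambda>u. u \<noteq> ?v) (L k)))"
    using sum.permute[OF exchange_permutes, of "\<lambda>k. mset (dropWhile (\<lambda>u. u \<noteq> ?v) (L k))"]
    by (simp add: comp_def)
  also have "(\<Sum>k=1..n. mset (takeWhile (\<lambda>u. u \<noteq> ?v) (L k))) + (\<Sum>k=1..n. mset (dropWhile (\<lambda>u. u \<noteq> ?v) (L k))) =
      (\<Sum>k=1..n. mset (L k))"
    by (simp flip: sum.distrib mset_append)
  finally show ?thesis
    using common_iff assms by auto
qed

text \<open>\<open>L'\<close> only has to agree with the exchanged lists on {1..n}, since the paths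
  of a family are restricted to these indices.\<close>

lemma swap_tails_swap_tails:
  assumes "\<And>k. k \<in> {1..n} \<Longrightarrow> distinct (L k)" "\<And>k. k \<in> {1..n} \<Longrightarrow> distinct (swap_tails n L k)"
    and "\<And>k. k \<in> {1..n} \<Longrightarrow> L' k = swap_tails n L k"
  shows "common n L' = common n L" "exchange n L' = exchange n L"
    and "k \<in> {1..n} \<Longrightarrow> swap_tails n L' k = L k"
proof -
  show common: "common n L' = common n L"
    using common_cong[of n L' "swap_tails n L"] common_swap_tails assms by simp
  have cr: "crossing n L \<in> set (L k) \<longleftrightarrow> crossing n L \<in> set (L' k)" if "k \<in> {1..n}" for k
    using crossing_swap_tails[of k] assms(3)[OF that] by simp
  show ex: "exchange n L' = exchange n L"
    using exchange_cong(2)[OF common[symmetric] cr] by simp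
  assume k: "k \<in> {1..n}"
  have "crossing n L' = crossing n L"
    using exchange_cong(1)[OF common[symmetric] cr] by simp
  then have "swap_tails n L' k = splice_at (crossing n L) (swap_tails n L k) (swap_tails n L (exchange n L k))"
    using k exchange_in[OF k] assms(3) by (simp add: swap_tails_def ex)
  also have "\<dots> = L k"
    using crossing_exchange[of k] by (simp add: swap_tails_def exchange_exchange splice_at_twice)
  finally show "swap_tails n L' k = L k" .
qed

end

text \<open>Each weight is head weight times tail weight, and an exchange merely permutes the tails.
  This requires one index \<open>j\<close> for all paths.\<close>

lemma prod_segment_weight_swap_tails:
  assumes "common n L \<noteq> {}"
  shows "(\<Prod>k=1..n. segment_weight X w j (swap_tails n L k)) = (\<Prod>k=1..n. segment_weight X w j (L k))"
proof -
  let ?v = "crossing n L" and ?\<tau> = "exchange n L"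
  \<comment> \<open>The head includes the crossing, so the step into it is counted in the head and
    the step out of it in the tail. Without the crossing the tail is empty and has weight 1.\<close>
  define hw where "hw p = (if ?v \<in> set p then segment_weight X w j (takeWhile (\<lambda>u. u \<noteq> ?v) p @ [?v])
    else segment_weight X w j p)" for p
  define tw where "tw p = segment_weight X w j (dropWhile (\<lambda>u. u \<noteq> ?v) p)" for p
  have splice: "segment_weight X w j (splice_at ?v p q) = hw p * tw q"
    if "?v \<in> set p \<longleftrightarrow> ?v \<in> set q" for p q
  proof (cases "?v \<in> set p")
    case True
    then obtain a b where p: "p = a @ ?v # b" "?v \<notin> set a"
      using split_list_first[OF True] by blast
    have "?v \<in> set q" using True that by simp
    then obtain a' b' where q: "q = a' @ ?v # b'" "?v \<notin> set a'"
      using split_list_first[of ?v q] by blast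
    note pq = p q
    have "takeWhile (\<lambda>u. u \<noteq> ?v) p = a" "dropWhile (\<lambda>u. u \<noteq> ?v) q = ?v # b'"
      using takeWhile_neq_split[OF p(2)] dropWhile_neq_split[OF q(2)] p(1) q(1) by simp_all
    moreover have "splice_at ?v p q = a @ ?v # b'"
      using splice_at_split[OF pq(2,4)] pq(1,3) by simp
    ultimately show ?thesis
      using True segment_weight_append[of X w j a ?v b'] by (simp add: hw_def tw_def)
  next
    case False
    then have q: "?v \<notin> set q" using that by simp
    have "takeWhile (\<lambda>u. u \<noteq> ?v) p = p"
      unfolding takeWhile_eq_all_conv using False by metis
    moreover have "dropWhile (\<lambda>u. u \<noteq> ?v) q = []"
      unfolding dropWhile_eq_Nil_conv using q by metis
    ultimately show ?thesis
      using False by (simp add: hw_def tw_def splice_at_def segment_weight_def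
          del: takeWhile_eq_all_conv dropWhile_eq_Nil_conv)
  qed
  have "(\<Prod>k=1..n. segment_weight X w j (swap_tails n L k)) = (\<Prod>k=1..n. hw (L k)) * (\<Prod>k=1..n. tw (L (?\<tau> k)))"
    unfolding swap_tails_def prod.distrib[symmetric] using crossing_exchange[OF assms]
    by (intro prod.cong refl splice) simp
  also have "(\<Prod>k=1..n. tw (L (?\<tau> k))) = (\<Prod>k=1..n. tw (L k))"
    using prod.permute[OF exchange_permutes[OF assms], of "\<lambda>k. tw (L k)"] by (simp add: comp_def)
  also have "(\<Prod>k=1..n. hw (L k)) * (\<Prod>k=1..n. tw (L k)) = (\<Prod>k=1..n. segment_weight X w j (L k))"
    unfolding prod.distrib[symmetric] using splice[of "L k" "L k" for k] by (intro prod.cong refl) simp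
  finally show ?thesis .
qed

section \<open>Exchanging tails inside families\<close>

lemma lattice_path_distinct:
  assumes "lattice_path S a b p" and "\<And>u s. s \<in> S \<Longrightarrow> f u < (f (u + s) :: int)"
  shows "distinct p"
proof -
  have "distinct p" if "sorted_wrt (\<lambda>u v. f u < f v) p"
    using that by (induction p) auto
  with lattice_path_strict_mono[OF assms] show ?thesis by blast
qed

lemma distinct_initial_path:
  assumes "lattice_path (initial_steps i s) a b p"
  shows "distinct p"
proof (cases "s = alpha i")
  case True
  then show ?thesis
    by (intro lattice_path_distinct[OF assms, where f = snd]) (auto simp: initial_steps_def)
next
  case False
  then show ?thesis
    by (intro lattice_path_distinct[OF assms, where f = fst]) (auto simp: initial_steps_def)
qed

lemma distinct_final_path: "lattice_path {(1, 0), (0, 1)} a b p \<Longrightarrow> distinct p"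
  by (erule lattice_path_distinct[where f = height]) (auto simp: height_def)

text \<open>The index matters only for steps (1,0), which do not occur in initial segments.\<close>

lemma segment_weight_initial:
  assumes "lattice_path (initial_steps i s) a b p"
  shows "segment_weight X w j p = segment_weight X w j' p"
  using assms
proof (induction p arbitrary: a)
  case (Cons u p)
  show ?case
  proof (cases "p = []")
    case False
    then obtain t where t: "t \<in> initial_steps i s" "lattice_path (initial_steps i s) (a + t) b p" "u = a"
      using Cons.prems by (auto simp: lattice_path_Cons)
    then have "hd p = u + t" by (simp add: lattice_path_def)
    with t(1) have "step_weight X w j u (hd p) = step_weight X w j' u (hd p)"
      by (auto simp: step_weight_def initial_steps_def split: if_splits)
    with Cons.IH[OF t(2)] False show ?thesis by (simp add: segment_weight_Cons)
  qed simp
qed simp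

lemma familiesD:
  assumes "F \<in> families n E" "k \<in> {1..n}"
  shows "start F k \<in> {alpha k, beta k}" "endpoint F k \<in> E (perm F k)"
    "perm F k \<in> {1..n}"
    "paths F k \<in> admissible_paths k (start F k) (endpoint F k)"
  using assms permutes_in_image[of "perm F" "{1..n}" k] by (auto simp: families_def PiE_iff)

lemma admissible_pathsD:
  assumes "\<pi> \<in> admissible_paths i s e"
  shows "lattice_path (initial_steps i s) s (last (fst \<pi>)) (fst \<pi>)"
    "height (last (fst \<pi>)) = 0" "last (fst \<pi>) = hd (snd \<pi>)" "\<forall>u\<in>set (fst \<pi>). height u \<le> 0"
    "lattice_path {(1, 0), (0, 1)} (hd (snd \<pi>)) e (snd \<pi>)"
  using assms by (auto simp: admissible_paths_def lattice_path_def)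

lemma admissible_pathsI:
  assumes "lattice_path (initial_steps i s) s P p" "height P = 0" "\<forall>u\<in>set p. height u \<le> 0"
    "lattice_path {(1, 0), (0, 1)} P e q"
  shows "(p, q) \<in> admissible_paths i s e"
  unfolding admissible_paths_def using assms by blast

text \<open>At the starting point \<epsilon> (x - y) = 2i > 0, and it never decreases. So initial
  segments of different type are separated by the diagonal.\<close>

lemma initial_path_side:
  assumes "\<pi> \<in> admissible_paths i s e" "i \<ge> 1" "u \<in> set (fst \<pi>)"
  shows "s = alpha i \<Longrightarrow> fst u < snd u" "s = beta i \<Longrightarrow> snd u < fst u"
proof -
  obtain c d where cd: "fst \<pi> = c @ u # d"
    using split_list[OF assms(3)] by blast
  have path: "lattice_path (initial_steps i s) s u (c @ [u])"
    using admissible_pathsD(1)[OF assms(1)] lattice_path_append[of _ s _ c u d]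
    unfolding cd by blast
  moreover have "\<forall>v\<in>set (c @ [u]). height v \<le> 0"
    using admissible_pathsD(4)[OF assms(1)] by (auto simp: cd)
  ultimately have mem: "c @ [u] \<in> initial_paths \<epsilon> s u" if "initial_steps i s = {(1, 1), (\<epsilon>, - \<epsilon>)}" for \<epsilon>
    using that by (simp add: initial_paths_def bounded_paths_def)
  show "fst u < snd u" if "s = alpha i"
    using initial_paths_mono[of "-1" "c @ [u]" s u] mem[of "-1"] initial_steps_alpha[of i] that assms(2)
    by (simp add: alpha_def)
  show "snd u < fst u" if "s = beta i"
    using initial_paths_mono[of 1 "c @ [u]" s u] mem[of 1] initial_steps_beta[of i] that assms(2)
    by (simp add: beta_def)
qed

text \<open>This makes an exchange of initial tails legal: the new tail uses only steps permitted
  for its new starting point.\<close>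

lemma initial_steps_eq_if_meet:
  assumes F: "F \<in> families n E" and k: "k \<in> {1..n}" "k' \<in> {1..n}"
    and u: "u \<in> set (fst (paths F k))" "u \<in> set (fst (paths F k'))"
  shows "initial_steps k (start F k) = initial_steps k' (start F k')"
proof -
  note side = initial_path_side[OF familiesD(4)[OF F k(1)] _ u(1)]
    initial_path_side[OF familiesD(4)[OF F k(2)] _ u(2)]
  have "k \<ge> 1" "k' \<ge> 1" using k by auto
  then have "start F k = alpha k \<longleftrightarrow> start F k' = alpha k'"
    using side familiesD(1)[OF F k(1)] familiesD(1)[OF F k(2)]
    by (smt (verit) insert_iff singletonD)
  then show ?thesis by (simp add: initial_steps_def)
qed

text \<open>Starting points stay, while endpoints and their indices travel with the tails. Hence
  only the permutation contributes to the change of sign.\<close>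

definition relink :: "(nat \<Rightarrow> nat) \<Rightarrow> (nat \<Rightarrow> path) \<Rightarrow> family \<Rightarrow> family" where
  "relink \<tau> \<pi> F = F\<lparr>perm := perm F \<circ> \<tau>, endpoint := endpoint F \<circ> \<tau>, paths := \<pi>\<rparr>"

lemma relink_families:
  assumes "F \<in> families n E" "\<tau> permutes {1..n}" "\<pi> \<in> extensional {1..n}"
    and "\<And>k. k \<in> {1..n} \<Longrightarrow> \<pi> k \<in> admissible_paths k (start F k) (endpoint F (\<tau> k))"
  shows "relink \<tau> \<pi> F \<in> families n E"
proof -
  have in_iff: "\<tau> k \<in> {1..n} \<longleftrightarrow> k \<in> {1..n}" for k
    by (rule permutes_in_image[OF assms(2)])
  have out: "\<tau> k = k" if "k \<notin> {1..n}" for k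
    by (rule permutes_not_in[OF assms(2) that])
  have "perm F \<circ> \<tau> permutes {1..n}"
    using assms(1,2) by (intro permutes_compose) (auto simp: families_def)
  moreover have "endpoint F \<circ> \<tau> \<in> (\<Pi>\<^sub>E k\<in>{1..n}. E ((perm F \<circ> \<tau>) k))"
  proof (rule PiE_I)
    fix k assume "k \<in> {1..n}"
    then show "(endpoint F \<circ> \<tau>) k \<in> E ((perm F \<circ> \<tau>) k)"
      using familiesD(2)[OF assms(1)] in_iff by simp
  next
    fix k assume "k \<notin> {1..n}"
    then show "(endpoint F \<circ> \<tau>) k = undefined"
      using assms(1) out[of k] by (simp add: families_def PiE_iff extensional_def)
  qed
  moreover have "\<pi> \<in> (\<Pi>\<^sub>E k\<in>{1..n}. admissible_paths k (start F k) ((endpoint F \<circ> \<tau>) k))"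
    using assms(3,4) by (simp add: PiE_iff)
  ultimately show ?thesis
    using assms(1) by (simp add: families_def relink_def)
qed

lemma family_sign_relink:
  assumes "F \<in> families n E" "\<tau> permutes {1..n}"
  shows "family_sign n (relink \<tau> \<pi> F) = sign \<tau> * family_sign n F"
proof -
  have "permutation (perm F)" "permutation \<tau>"
    using assms permutation_permutes by (auto simp: families_def)
  then show ?thesis
    by (simp add: family_sign_def relink_def sign_compose)
qed

lemma relink_relink:
  assumes "F \<in> families n E" "\<And>k. \<tau> (\<tau> k) = k" "\<And>k. k \<in> {1..n} \<Longrightarrow> \<pi>' k = paths F k" "\<pi>' \<in> extensional {1..n}"
  shows "relink \<tau> \<pi>' (relink \<tau> \<pi> F) = F"
proof -
  have "\<pi>' = paths F"
    using assms(1,3,4) by (intro extensionalityI[of _ "{1..n}"]) (simp_all add: families_def PiE_iff)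
  then show ?thesis
    using assms(2) by (simp add: relink_def comp_def)
qed

lemma family_sign_cases: "family_sign n F \<in> {1, -1}"
  by (cases "evenperm (perm F)"; cases "even (card {i \<in> {1..n}. start F i = beta i})")
    (auto simp: family_sign_def sign_def)

lemma family_weight_eq:
  assumes "F \<in> families n E"
  shows "family_weight X w n F = (\<Prod>k=1..n. segment_weight X w 0 (fst (paths F k))) *
    (\<Prod>k=1..n. segment_weight X w (perm F k) (snd (paths F k)))"
  unfolding family_weight_def path_weight_def prod.distrib[symmetric]
proof (rule prod.cong[OF refl])
  fix k assume "k \<in> {1..n}"
  from segment_weight_initial[OF admissible_pathsD(1)[OF familiesD(4)[OF assms this]], of X w "perm F k" 0]
  show "segment_weight X w (perm F k) (fst (paths F k)) * segment_weight X w (perm F k) (snd (paths F k)) =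
      segment_weight X w 0 (fst (paths F k)) * segment_weight X w (perm F k) (snd (paths F k))"
    by simp
qed

text \<open>The final segment is carried along as part of the tail and keeps its endpoint
  index.\<close>

definition swap_initial :: "nat \<Rightarrow> family \<Rightarrow> family" where
  "swap_initial n F = (let L = \<lambda>k. fst (paths F k) in
     relink (exchange n L) (\<lambda>k\<in>{1..n}. (swap_tails n L k, snd (paths F (exchange n L k)))) F)"

definition swap_final :: "nat \<Rightarrow> family \<Rightarrow> family" where
  "swap_final n F = (let L = \<lambda>k. snd (paths F k) in
     relink (exchange n L) (\<lambda>k\<in>{1..n}. (fst (paths F k), swap_tails n L k)) F)"

text \<open>The weight is preserved for every w: initial weights do not see the index, and every
  final segment is moved as a whole together with its index.\<close>

lemma swap_initial:
  assumes F: "F \<in> families n E" and ne: "common n (\<lambda>k. fst (paths F k)) \<noteq> {}"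
  shows "swap_initial n F \<in> families n E"
    and "common n (\<lambda>k. fst (paths (swap_initial n F) k)) \<noteq> {}"
    and "swap_initial n (swap_initial n F) = F"
    and "family_sign n (swap_initial n F) = - family_sign n F"
    and "family_weight X w n (swap_initial n F) = family_weight X w n F"
proof -
  define L where "L k = fst (paths F k)" for k
  define \<tau> where "\<tau> = exchange n L"
  define \<pi> where "\<pi> = (\<lambda>k\<in>{1..n}. (swap_tails n L k, snd (paths F (\<tau> k))))"
  define F' where "F' = relink \<tau> \<pi> F"
  have F'_eq: "swap_initial n F = F'"
    unfolding swap_initial_def Let_def F'_def \<pi>_def \<tau>_def L_def ..
  have ne': "common n L \<noteq> {}"
    using ne by (simp add: L_def[abs_def])
  note perm = exchange_permutes[OF ne', folded \<tau>_def] and inv = exchange_exchange[OF ne', folded \<tau>_def]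
  have adm: "\<pi> k \<in> admissible_paths k (start F k) (endpoint F (\<tau> k))" if k: "k \<in> {1..n}" for k
  proof -
    have \<tau>k: "\<tau> k \<in> {1..n}" using exchange_in[OF ne' k] by (simp add: \<tau>_def)
    note A = admissible_pathsD[OF familiesD(4)[OF F k]]
      and B = admissible_pathsD[OF familiesD(4)[OF F \<tau>k]]
    consider "\<tau> k = k" | "crossing n L \<in> set (L k)" "crossing n L \<in> set (L (\<tau> k))"
      using exchange_cases[OF ne', of k] by (auto simp: \<tau>_def)
    then show ?thesis
    proof cases
      case 1
      then have "\<pi> k = paths F k"
        using k by (simp add: \<pi>_def swap_tails_def \<tau>_def[symmetric] L_def)
      with 1 familiesD(4)[OF F k] show ?thesis by simp
    next
      case 2
      have steps: "initial_steps k (start F k) = initial_steps (\<tau> k) (start F (\<tau> k))"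
        using 2 by (intro initial_steps_eq_if_meet[OF F k \<tau>k]) (auto simp: L_def)
      have "lattice_path (initial_steps k (start F k)) (start F k) (last (L (\<tau> k))) (swap_tails n L k)"
        unfolding swap_tails_def \<tau>_def[symmetric]
        by (rule lattice_path_splice_at[OF A(1)[folded L_def] B(1)[folded L_def steps] 2])
      moreover have "\<forall>u\<in>set (swap_tails n L k). height u \<le> 0"
        using A(4) B(4) set_splice_at[of "crossing n L" "L k" "L (\<tau> k)"]
        unfolding swap_tails_def \<tau>_def[symmetric] L_def by blast
      ultimately have "(swap_tails n L k, snd (paths F (\<tau> k))) \<in> admissible_paths k (start F k) (endpoint F (\<tau> k))"
        using B(2,3,5) by (intro admissible_pathsI[where P = "last (L (\<tau> k))"]) (simp_all add: L_def)
      with k show ?thesis by (simp add: \<pi>_def)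
    qed
  qed
  show fam: "swap_initial n F \<in> families n E"
    unfolding F'_eq F'_def
    by (rule relink_families[OF F perm _ adm]) (simp_all only: \<pi>_def restrict_extensional)
  have L': "fst (paths F' k) = swap_tails n L k" if "k \<in> {1..n}" for k
    using that by (simp add: F'_def relink_def \<pi>_def)
  have d: "distinct (L k)" "distinct (swap_tails n L k)" if "k \<in> {1..n}" for k
    using distinct_initial_path[OF admissible_pathsD(1)[OF familiesD(4)[OF F that]]]
      distinct_initial_path[OF admissible_pathsD(1)[OF familiesD(4)[OF fam that]]] L'[OF that]
    by (simp_all add: L_def F'_eq)
  note twice = swap_tails_swap_tails[OF ne' d L']
  show "common n (\<lambda>k. fst (paths (swap_initial n F) k)) \<noteq> {}"
    using twice(1) ne' by (simp add: F'_eq)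
  have "swap_initial n F' = relink \<tau> (\<lambda>k\<in>{1..n}. (swap_tails n (\<lambda>k. fst (paths F' k)) k, snd (paths F' (\<tau> k)))) F'"
    using twice(2) by (simp add: swap_initial_def Let_def \<tau>_def)
  also have "\<dots> = F"
  proof (rule relink_relink[OF F inv, where \<pi> = \<pi>, folded F'_def])
    fix k assume k: "k \<in> {1..n}"
    then have "\<tau> k \<in> {1..n}" using exchange_in[OF ne' k] by (simp add: \<tau>_def)
    then show "(\<lambda>k\<in>{1..n}. (swap_tails n (\<lambda>k. fst (paths F' k)) k, snd (paths F' (\<tau> k)))) k = paths F k"
      using twice(3)[OF _ _ _ k] k by (simp add: L_def F'_def relink_def \<pi>_def inv)
  qed (rule restrict_extensional)
  finally show "swap_initial n (swap_initial n F) = F" by (simp only: F'_eq)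
  show "family_sign n (swap_initial n F) = - family_sign n F"
    unfolding F'_eq F'_def family_sign_relink[OF F perm]
    using sign_exchange[OF ne'] by (simp add: \<tau>_def)
  have "(\<Prod>k=1..n. segment_weight X w 0 (fst (paths F' k))) = (\<Prod>k=1..n. segment_weight X w 0 (fst (paths F k)))"
    using prod_segment_weight_swap_tails[OF ne', of X w 0] L' by (simp add: L_def)
  moreover have "(\<Prod>k=1..n. segment_weight X w (perm F' k) (snd (paths F' k))) =
      (\<Prod>k=1..n. segment_weight X w (perm F k) (snd (paths F k)))"
    using prod.permute[OF perm, of "\<lambda>k. segment_weight X w (perm F k) (snd (paths F k))"]
    by (simp add: F'_def relink_def \<pi>_def comp_def)
  ultimately show "family_weight X w n (swap_initial n F) = family_weight X w n F"
    unfolding family_weight_eq[OF F] family_weight_eq[OF fam] by (simp add: F'_eq)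
qed

text \<open>No weight is compared here, as the head of a final segment receives a new index. That
  the initial segments stay in place preserves their disjointness.\<close>

lemma swap_final:
  assumes F: "F \<in> families n E" and ne: "common n (\<lambda>k. snd (paths F k)) \<noteq> {}"
  shows "swap_final n F \<in> families n E"
    and "common n (\<lambda>k. snd (paths (swap_final n F) k)) \<noteq> {}"
    and "swap_final n (swap_final n F) = F"
    and "family_sign n (swap_final n F) = - family_sign n F"
    and "k \<in> {1..n} \<Longrightarrow> fst (paths (swap_final n F) k) = fst (paths F k)"
proof -
  define L where "L k = snd (paths F k)" for k
  define \<tau> where "\<tau> = exchange n L"
  define \<pi> where "\<pi> = (\<lambda>k\<in>{1..n}. (fst (paths F k), swap_tails n L k))"
  define F' where "F' = relink \<tau> \<pi> F"
  have F'_eq: "swap_final n F = F'"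
    unfolding swap_final_def Let_def F'_def \<pi>_def \<tau>_def L_def ..
  have ne': "common n L \<noteq> {}"
    using ne by (simp add: L_def[abs_def])
  note perm = exchange_permutes[OF ne', folded \<tau>_def] and inv = exchange_exchange[OF ne', folded \<tau>_def]
  have adm: "\<pi> k \<in> admissible_paths k (start F k) (endpoint F (\<tau> k))" if k: "k \<in> {1..n}" for k
  proof -
    have \<tau>k: "\<tau> k \<in> {1..n}" using exchange_in[OF ne' k] by (simp add: \<tau>_def)
    note A = admissible_pathsD[OF familiesD(4)[OF F k]]
      and B = admissible_pathsD[OF familiesD(4)[OF F \<tau>k]]
    consider "\<tau> k = k" | "crossing n L \<in> set (L k)" "crossing n L \<in> set (L (\<tau> k))"
      using exchange_cases[OF ne', of k] by (auto simp: \<tau>_def)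
    then show ?thesis
    proof cases
      case 1
      then have "\<pi> k = paths F k"
        using k by (simp add: \<pi>_def swap_tails_def \<tau>_def[symmetric] L_def)
      with 1 familiesD(4)[OF F k] show ?thesis by simp
    next
      case 2
      have "lattice_path {(1, 0), (0, 1)} (hd (L k)) (endpoint F (\<tau> k)) (swap_tails n L k)"
        unfolding swap_tails_def \<tau>_def[symmetric]
        by (rule lattice_path_splice_at[OF A(5)[folded L_def] B(5)[folded L_def] 2])
      then have "(fst (paths F k), swap_tails n L k) \<in> admissible_paths k (start F k) (endpoint F (\<tau> k))"
        using A by (intro admissible_pathsI[where P = "hd (L k)"]) (simp_all add: L_def)
      with k show ?thesis by (simp add: \<pi>_def)
    qed
  qed
  show fam: "swap_final n F \<in> families n E"
    unfolding F'_eq F'_def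
    by (rule relink_families[OF F perm _ adm]) (simp_all only: \<pi>_def restrict_extensional)
  have L': "snd (paths F' k) = swap_tails n L k" if "k \<in> {1..n}" for k
    using that by (simp add: F'_def relink_def \<pi>_def)
  have d: "distinct (L k)" "distinct (swap_tails n L k)" if "k \<in> {1..n}" for k
    using distinct_final_path[OF admissible_pathsD(5)[OF familiesD(4)[OF F that]]]
      distinct_final_path[OF admissible_pathsD(5)[OF familiesD(4)[OF fam that]]] L'[OF that]
    by (simp_all add: L_def F'_eq)
  note twice = swap_tails_swap_tails[OF ne' d L']
  show "common n (\<lambda>k. snd (paths (swap_final n F) k)) \<noteq> {}"
    using twice(1) ne' by (simp add: F'_eq)
  have "swap_final n F' = relink \<tau> (\<lambda>k\<in>{1..n}. (fst (paths F' k), swap_tails n (\<lambda>k. snd (paths F' k)) k)) F'"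
    using twice(2) by (simp add: swap_final_def Let_def \<tau>_def)
  also have "\<dots> = F"
  proof (rule relink_relink[OF F inv, where \<pi> = \<pi>, folded F'_def])
    fix k assume k: "k \<in> {1..n}"
    then show "(\<lambda>k\<in>{1..n}. (fst (paths F' k), swap_tails n (\<lambda>k. snd (paths F' k)) k)) k = paths F k"
      using twice(3)[OF _ _ _ k] by (simp add: L_def F'_def relink_def \<pi>_def)
  qed (rule restrict_extensional)
  finally show "swap_final n (swap_final n F) = F" by (simp only: F'_eq)
  show "family_sign n (swap_final n F) = - family_sign n F"
    unfolding F'_eq F'_def family_sign_relink[OF F perm]
    using sign_exchange[OF ne'] by (simp add: \<tau>_def)
  show "fst (paths (swap_final n F) k) = fst (paths F k)" if "k \<in> {1..n}"
    using that by (simp add: F'_eq F'_def relink_def \<pi>_def)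
qed

lemma initially_disjoint_iff:
  "F \<in> initially_disjoint_families n E \<longleftrightarrow> F \<in> families n E \<and> common n (\<lambda>k. fst (paths F k)) = {}"
  unfolding initially_disjoint_families_def common_def initial_vertices_def by blast

lemma sum_initially_disjoint_families:
  assumes "finite (families n E)"
  shows "(\<Sum>F\<in>initially_disjoint_families n E. of_int (family_sign n F) * family_weight X w n F) =
    (\<Sum>F\<in>families n E. of_int (family_sign n F) * family_weight X w n F)"
proof -
  let ?A = "families n E - initially_disjoint_families n E"
  have A: "F \<in> ?A \<longleftrightarrow> F \<in> families n E \<and> common n (\<lambda>k. fst (paths F k)) \<noteq> {}" for F
    by (auto simp: initially_disjoint_iff)
  have "(\<Sum>F\<in>?A. of_int (family_sign n F) * family_weight X w n F) = 0"
  proof (rule sum_sign_reversing_involution[where f = "swap_initial n"])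
    fix F assume "F \<in> ?A"
    then have "F \<in> families n E" "common n (\<lambda>k. fst (paths F k)) \<noteq> {}"
      unfolding A by blast+
    note sw = swap_initial[OF this]
    from sw show "swap_initial n F \<in> ?A" unfolding A by blast
    show "swap_initial n (swap_initial n F) = F" "family_sign n (swap_initial n F) = - family_sign n F"
      "family_weight X w n (swap_initial n F) = family_weight X w n F"
      using sw by simp_all
  qed (use assms family_sign_cases in auto)
  moreover have "initially_disjoint_families n E \<subseteq> families n E"
    by (auto simp: initially_disjoint_iff)
  ultimately show ?thesis
    using sum.subset_diff[OF _ assms, of "initially_disjoint_families n E"
        "\<lambda>F. of_int (family_sign n F) * family_weight X w n F"] by simp
qed

text \<open>Initial segments lie in x + y \<le> 0 and final ones in x + y \<ge> 0. A vertex on an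
  initial segment of one path and the final segment of another must be the point where the latter
  leaves x + y = 0, which also ends its initial segment.\<close>

lemma disjoint_iff:
  "F \<in> disjoint_families n E \<longleftrightarrow>
    F \<in> initially_disjoint_families n E \<and> common n (\<lambda>k. snd (paths F k)) = {}"
proof
  assume "F \<in> disjoint_families n E"
  then show "F \<in> initially_disjoint_families n E \<and> common n (\<lambda>k. snd (paths F k)) = {}"
    unfolding disjoint_families_def initially_disjoint_families_def vertices_def initial_vertices_def
      common_def by blast
next
  assume *: "F \<in> initially_disjoint_families n E \<and> common n (\<lambda>k. snd (paths F k)) = {}"
  then have F: "F \<in> families n E" by (simp add: initially_disjoint_iff)
  have ini: "u \<notin> set (fst (paths F j))" if "i \<in> {1..n}" "j \<in> {1..n}" "i \<noteq> j" "u \<in> set (fst (paths F i))" for i j u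
    using * that unfolding initially_disjoint_families_def initial_vertices_def by blast
  have mixed: "u \<notin> set (snd (paths F j))" if ij: "i \<in> {1..n}" "j \<in> {1..n}" "i \<noteq> j" and u: "u \<in> set (fst (paths F i))" for i j u
  proof
    assume uj: "u \<in> set (snd (paths F j))"
    note A = admissible_pathsD[OF familiesD(4)[OF F ij(1)]]
      and B = admissible_pathsD[OF familiesD(4)[OF F ij(2)]]
    let ?q = "snd (paths F j)" and ?P = "hd (snd (paths F j))"
    have "height ?P \<le> height u" "fst ?P \<le> fst u" "snd ?P \<le> snd u"
      using final_path_bounds[OF B(5) uj] by auto
    moreover have "height u \<le> 0" "height ?P = 0"
      using A(4) u B(2,3) by auto
    ultimately have "u = ?P"
      by (auto simp: height_def prod_eq_iff)
    moreover have "last (fst (paths F j)) \<in> set (fst (paths F j))"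
      using B(1) by (simp add: lattice_path_def)
    ultimately show False
      using ini[OF ij u] B(3) by simp
  qed
  have fin: "u \<notin> set (snd (paths F j))" if "i \<in> {1..n}" "j \<in> {1..n}" "i \<noteq> j" "u \<in> set (snd (paths F i))" for i j u
    using * that unfolding common_def by blast
  have "vertices (paths F i) \<inter> vertices (paths F j) = {}" if "i \<in> {1..n}" "j \<in> {1..n}" "i \<noteq> j" for i j
    using ini[OF that] mixed[OF that] mixed[OF that(2,1) that(3)[symmetric]] fin[OF that]
    unfolding vertices_def by blast
  with F show "F \<in> disjoint_families n E"
    unfolding disjoint_families_def by blast
qed

text \<open>Under \<open>one\<close> the weight depends only on the initial segments, which
  \<open>swap_final\<close> leaves unchanged.\<close>

lemma sum_disjoint_families:
  assumes "finite (families n E)"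
    and one: "\<And>F k. F \<in> families n E \<Longrightarrow> k \<in> {1..n} \<Longrightarrow> segment_weight X w (perm F k) (snd (paths F k)) = 1"
  shows "(\<Sum>F\<in>disjoint_families n E. of_int (family_sign n F) * family_weight X w n F) =
    (\<Sum>F\<in>initially_disjoint_families n E. of_int (family_sign n F) * family_weight X w n F)"
proof -
  let ?I = "initially_disjoint_families n E"
  let ?A = "?I - disjoint_families n E"
  have A: "F \<in> ?A \<longleftrightarrow> F \<in> families n E \<and> common n (\<lambda>k. fst (paths F k)) = {}
      \<and> common n (\<lambda>k. snd (paths F k)) \<noteq> {}" for F
    by (auto simp: initially_disjoint_iff disjoint_iff)
  have fin: "finite ?I"
    using assms(1) by (rule finite_subset[rotated]) (auto simp: initially_disjoint_iff)
  have weight: "family_weight X w n F = (\<Prod>k=1..n. segment_weight X w 0 (fst (paths F k)))"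
    if "F \<in> families n E" for F
    using family_weight_eq[OF that, of X w] one[OF that] by simp
  have "(\<Sum>F\<in>?A. of_int (family_sign n F) * family_weight X w n F) = 0"
  proof (rule sum_sign_reversing_involution[where f = "swap_final n"])
    fix F assume "F \<in> ?A"
    then have F: "F \<in> families n E" "common n (\<lambda>k. fst (paths F k)) = {}" "common n (\<lambda>k. snd (paths F k)) \<noteq> {}"
      unfolding A by blast+
    note sw = swap_final[OF F(1,3)]
    have "common n (\<lambda>k. fst (paths (swap_final n F) k)) = {}"
      using F(2) common_cong[OF sw(5)] by simp
    with sw show "swap_final n F \<in> ?A" unfolding A by blast
    show "swap_final n (swap_final n F) = F" "family_sign n (swap_final n F) = - family_sign n F"
      using sw by simp_all
    show "family_weight X w n (swap_final n F) = family_weight X w n F"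
      unfolding weight[OF F(1)] weight[OF sw(1)] using sw(5) by simp
  qed (use fin family_sign_cases in auto)
  moreover have "disjoint_families n E \<subseteq> ?I"
    by (auto simp: disjoint_iff)
  ultimately show ?thesis
    using sum.subset_diff[OF _ fin, of "disjoint_families n E"
        "\<lambda>F. of_int (family_sign n F) * family_weight X w n F"] by simp
qed

subsection \<open>The order of disjoint paths\<close>

text \<open>Each step raises the height by one, so both paths are followed at equal height. Their
  horizontal distance drops by at most one per step and cannot reach 0 without a common vertex. The
  second path ends at least as high, so it outlasts the first and can only move further
  right.\<close>

lemma final_paths_ordered:
  assumes "lattice_path {(1, 0), (0, 1)} a b p" "lattice_path {(1, 0), (0, 1)} a' b' p'"
    and "set p \<inter> set p' = {}" "height a = height a'" "fst a < fst a'" "height b \<le> height b'"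
  shows "fst b < fst b'"
  using assms
proof (induction p arbitrary: a a' p')
  case Nil
  then show ?case by simp
next
  case (Cons u p)
  have bounds: "height a \<le> height b" "fst a' \<le> fst b'"
    using final_path_bounds(1)[OF Cons.prems(1), of b] final_path_bounds(4)[OF Cons.prems(2), of a']
      Cons.prems(1,2) hd_in_set[of p'] last_in_set[of "u # p"]
    by (auto simp: lattice_path_def)
  show ?case
  proof (cases "p = []")
    case True
    with Cons.prems bounds show ?thesis by (auto simp: lattice_path_Cons)
  next
    case False
    then obtain s where s: "s \<in> {(1, 0), (0, 1)}" "lattice_path {(1, 0), (0, 1)} (a + s) b p"
      using Cons.prems(1) by (auto simp: lattice_path_Cons)
    have hd: "hd p = a + s" "hd p \<in> set p"
      using s(2) hd_in_set[OF False] by (auto simp: lattice_path_def)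
    have "last p \<in> set p" using False by simp
    then have "height (a + s) \<le> height b"
      using final_path_bounds(1)[OF s(2), of b] s(2) by (simp add: lattice_path_def)
    then have "height a' < height b'"
      using s(1) Cons.prems(4,6) by (auto simp: height_def)
    obtain u' q where p': "p' = u' # q"
      using Cons.prems(2) by (cases p') auto
    have "q \<noteq> []"
      using Cons.prems(2) \<open>height a' < height b'\<close> by (auto simp: p' lattice_path_Cons)
    then obtain s' where s': "s' \<in> {(1, 0), (0, 1)}" "lattice_path {(1, 0), (0, 1)} (a' + s') b' q"
      using Cons.prems(2) by (auto simp: p' lattice_path_Cons)
    have hd': "hd q = a' + s'" "hd q \<in> set q"
      using s'(2) hd_in_set[OF \<open>q \<noteq> []\<close>] by (auto simp: lattice_path_def)
    have h: "height (a + s) = height (a' + s')"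
      using s(1) s'(1) Cons.prems(4) by (auto simp: height_def)
    have "a + s \<noteq> a' + s'"
      using hd hd' Cons.prems(3) by (auto simp: p')
    with h have "fst (a + s) \<noteq> fst (a' + s')"
      by (auto simp: height_def prod_eq_iff)
    moreover have "fst (a + s) \<le> fst (a' + s')"
      using s(1) s'(1) Cons.prems(5) by auto
    ultimately have "fst (a + s) < fst (a' + s')" by simp
    with Cons.IH[OF s(2) s'(2) _ h] Cons.prems(3,6) show ?thesis by (auto simp: p')
  qed
qed

text \<open>Invariant: the primed path is at most as high as the other and strictly ahead in
  \<delta>, with even distance. Since possibly only one path advances, the induction is on the total
  length.\<close>

lemma initial_paths_ordered:
  fixes \<epsilon> :: int
  defines "\<delta> \<equiv> \<lambda>u. \<epsilon> * (fst u - snd u)"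
  assumes eps: "\<epsilon> \<in> {1, -1}"
    and "lattice_path {(1, 1), (\<epsilon>, - \<epsilon>)} a b p" "lattice_path {(1, 1), (\<epsilon>, - \<epsilon>)} a' b' p'"
    and "\<forall>u\<in>set p. height u \<le> 0" "\<forall>u\<in>set p'. height u \<le> 0" "height b = 0" "height b' = 0"
    and "set p \<inter> set p' = {}" "height a' \<le> height a" "\<delta> a < \<delta> a'" "even (\<delta> a' - \<delta> a)"
  shows "\<delta> b < \<delta> b'"
  using assms(3-)
proof (induction "length p + length p'" arbitrary: a a' p p' rule: less_induct)
  case less
  note P = less.prems
  obtain q q' where q: "p = a # q" "p' = a' # q'"
    using P(1,2) by (cases p; cases p') (auto simp: lattice_path_Cons)
  have par: "even (height a' - height a)"
    using P(10) eps by (auto simp: \<delta>_def height_def)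
  have up: "\<delta> (u + (1, 1)) = \<delta> u" "height (u + (1, 1)) = height u + 2" for u
    by (simp_all add: \<delta>_def height_def)
  have flat: "\<delta> (u + (\<epsilon>, - \<epsilon>)) = \<delta> u + 2" "height (u + (\<epsilon>, - \<epsilon>)) = height u" for u
    using eps by (auto simp: \<delta>_def height_def)
  have step: "\<exists>s. s \<in> {(1, 1), (\<epsilon>, - \<epsilon>)} \<and> lattice_path {(1, 1), (\<epsilon>, - \<epsilon>)} (c + s) d r \<and> c + s \<in> set r"
    if r: "lattice_path {(1, 1), (\<epsilon>, - \<epsilon>)} c d (c # r)" "r \<noteq> []" for c d r
  proof -
    obtain s where s: "s \<in> {(1, 1), (\<epsilon>, - \<epsilon>)}" "lattice_path {(1, 1), (\<epsilon>, - \<epsilon>)} (c + s) d r"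
      using r unfolding lattice_path_Cons by auto
    moreover have "c + s \<in> set r"
      using s(2) hd_in_set[OF r(2)] by (simp add: lattice_path_def)
    ultimately show ?thesis by blast
  qed
  have end': "a = b" if "q = []" and "lattice_path {(1, 1), (\<epsilon>, - \<epsilon>)} a b (a # q)" for a b q
    using that by (simp add: lattice_path_Cons)
  show ?case
  proof (cases "height a' = height a")
    case False
    with P(8) par have lt: "height a' + 2 \<le> height a" by presburger
    have "height a \<le> 0" using P(3) q by simp
    then have "q' \<noteq> []" using end'[of q' a' b'] P(2,6) lt q by auto
    then obtain s where s: "s \<in> {(1, 1), (\<epsilon>, - \<epsilon>)}" "lattice_path {(1, 1), (\<epsilon>, - \<epsilon>)} (a' + s) b' q'"
      using step P(2) q by blast
    have "height (a' + s) \<le> height a" "\<delta> a < \<delta> (a' + s)" "even (\<delta> (a' + s) - \<delta> a)"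
      using s(1) lt P(9,10) up[of a'] flat[of a'] by auto
    with less.hyps[of p q' a "a' + s"] s(2) P q show ?thesis by auto
  next
    case True
    \<comment> \<open>In \<open>flat1\<close> parity leaves a distance of at least 2, and a distance
      of exactly 2 would be a common vertex. In \<open>up1\<close> and \<open>up2\<close> one path
      has already ended at height 0, so the other would rise above 0.\<close>
    consider (flat1) "q \<noteq> []" "lattice_path {(1, 1), (\<epsilon>, - \<epsilon>)} (a + (\<epsilon>, - \<epsilon>)) b q" "a + (\<epsilon>, - \<epsilon>) \<in> set q"
      | (flat2) "q' \<noteq> []" "lattice_path {(1, 1), (\<epsilon>, - \<epsilon>)} (a' + (\<epsilon>, - \<epsilon>)) b' q'"
      | (up) "lattice_path {(1, 1), (\<epsilon>, - \<epsilon>)} (a + (1, 1)) b q" "lattice_path {(1, 1), (\<epsilon>, - \<epsilon>)} (a' + (1, 1)) b' q'"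
      | (up1) "q' = []" "a + (1, 1) \<in> set q" | (up2) "q = []" "a' + (1, 1) \<in> set q'" | (stop) "q = []" "q' = []"
      using step[of a b q] step[of a' b' q'] P(1,2) q by blast
    then show ?thesis
    proof cases
      case flat1
      have "a + (\<epsilon>, - \<epsilon>) \<noteq> a'" using flat1(3) P(7) q by auto
      moreover have "a + (\<epsilon>, - \<epsilon>) = a'" if "\<delta> (a + (\<epsilon>, - \<epsilon>)) = \<delta> a'"
        using that flat(2)[of a] True eps by (auto simp: \<delta>_def height_def prod_eq_iff)
      ultimately have ne: "\<delta> a + 2 \<noteq> \<delta> a'" using flat[of a] by auto
      have "\<delta> a + 2 \<le> \<delta> a'" using P(9,10) by presburger
      with ne have "\<delta> (a + (\<epsilon>, - \<epsilon>)) < \<delta> a'" using flat[of a] by simp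
      with less.hyps[of q p' "a + (\<epsilon>, - \<epsilon>)" a'] flat1(2) P q flat[of a] True show ?thesis by auto
    next
      case flat2
      with less.hyps[of p q' a "a' + (\<epsilon>, - \<epsilon>)"] P q flat[of a'] True show ?thesis by auto
    next
      case up
      with less.hyps[of q q' "a + (1, 1)" "a' + (1, 1)"] P q \<open>\<And>u. \<delta> (u + (1, 1)) = \<delta> u\<close>
        \<open>\<And>u. height (u + (1, 1)) = height u + 2\<close> True show ?thesis by auto
    next
      case up1
      then have "a' = b'" using end' P(2) q by blast
      with up1 P(3,6) True q \<open>\<And>u. height (u + (1, 1)) = height u + 2\<close>[of a] show ?thesis by force
    next
      case up2
      then have "a = b" using end' P(1) q by blast
      with up2 P(4,5) True q \<open>\<And>u. height (u + (1, 1)) = height u + 2\<close>[of a'] show ?thesis by force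
    next
      case stop
      then have "a = b" "a' = b'" using end' P(1,2) q by blast+
      with P(9) show ?thesis by simp
    qed
  qed
qed

section \<open>Signs of permutations whose values are successive extrema\<close>

definition rotation :: "nat \<Rightarrow> nat \<Rightarrow> nat" where
  "rotation n k = (if k = 1 then Suc n else if 1 < k \<and> k \<le> Suc n then k - 1 else k)"

lemma rotation_0: "rotation 0 = id"
  by (rule ext) (auto simp: rotation_def)

lemma rotation_Suc: "rotation (Suc n) = transpose (Suc n) (Suc (Suc n)) \<circ> rotation n"
  by (rule ext) (auto simp: rotation_def transpose_def)

lemma rotation_permutes: "rotation n permutes {1..Suc n}"
proof (induction n)
  case (Suc n)
  have "rotation n permutes {1..Suc (Suc n)}"
    by (rule permutes_subset[OF Suc]) auto
  then show ?case
    unfolding rotation_Suc by (intro permutes_compose permutes_swap_id) auto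
qed (simp only: rotation_0 permutes_id)

lemma sign_rotation: "sign (rotation n) = (-1) ^ n"
proof (induction n)
  case (Suc n)
  have "permutation (rotation n)"
    by (rule permutes_imp_permutation[OF _ rotation_permutes]) simp
  then show ?case
    unfolding rotation_Suc by (subst sign_compose) (simp_all add: permutation_swap_id sign_swap_id Suc)
qed (simp add: rotation_0)

text \<open>Each value is a new minimum (index in \<open>B\<close>) or a new maximum among its
  predecessors, so index i ends i - 1 inversions or none. In the induction a last value 1 is rotated
  to the top by a cycle of sign (-1)^n.\<close>

lemma sign_of_extremal_permutation:
  assumes "\<sigma> permutes {1..n}"
    and "\<And>i i'. i \<in> {1..n} \<Longrightarrow> i' \<in> {1..n} \<Longrightarrow> i < i' \<Longrightarrow> \<sigma> i' < \<sigma> i \<longleftrightarrow> i' \<in> B"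
  shows "sign \<sigma> = (-1) ^ (\<Sum>i\<in>{1..n} \<inter> B. i - 1)"
  using assms
proof (induction n arbitrary: \<sigma>)
  case 0
  then show ?case by simp
next
  case (Suc n)
  note \<sigma> = Suc.prems(1)
  have shrink: "\<tau> permutes {1..n}" if "\<tau> permutes {1..Suc n}" "\<tau> (Suc n) = Suc n" for \<tau>
    using that(1) by (rule permutes_superset) (use that(2) in \<open>auto simp: le_Suc_eq\<close>)
  have set_eq: "{1..Suc n} \<inter> B = (if Suc n \<in> B then insert (Suc n) ({1..n} \<inter> B) else {1..n} \<inter> B)"
    by (auto simp: le_Suc_eq)
  have range: "\<sigma> i \<in> {1..Suc n} \<longleftrightarrow> i \<in> {1..Suc n}" for i
    by (rule permutes_in_image[OF \<sigma>])
  have inj: "\<sigma> i = \<sigma> k \<longleftrightarrow> i = k" for i k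
    using permutes_inj[OF \<sigma>] by (auto dest: injD)
  show ?case
  proof (cases "Suc n \<in> B")
    case False
    obtain i where i: "\<sigma> i = Suc n" using permutes_surj[OF \<sigma>] by (metis surjD)
    then have "i \<in> {1..Suc n}" using range[of i] by simp
    have "i = Suc n"
    proof (rule ccontr)
      assume "i \<noteq> Suc n"
      with \<open>i \<in> {1..Suc n}\<close> Suc.prems(2)[of i "Suc n"] False have "\<sigma> (Suc n) \<ge> \<sigma> i" by auto
      with range[of "Suc n"] i inj[of i "Suc n"] \<open>i \<noteq> Suc n\<close> show False by auto
    qed
    with i \<sigma> have "\<sigma> permutes {1..n}" by (intro shrink) auto
    then have "sign \<sigma> = (-1) ^ (\<Sum>i\<in>{1..n} \<inter> B. i - 1)"
      by (rule Suc.IH) (use Suc.prems(2) in auto)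
    with False show ?thesis by (simp only: set_eq if_False)
  next
    case True
    obtain i where i: "\<sigma> i = 1" using permutes_surj[OF \<sigma>] by (metis surjD)
    then have "i \<in> {1..Suc n}" using range[of i] by simp
    have "i = Suc n"
    proof (rule ccontr)
      assume "i \<noteq> Suc n"
      with \<open>i \<in> {1..Suc n}\<close> Suc.prems(2)[of i "Suc n"] True have "\<sigma> (Suc n) < \<sigma> i" by auto
      with range[of "Suc n"] i show False by auto
    qed
    define \<tau> where "\<tau> = rotation n \<circ> \<sigma>"
    have "\<tau> permutes {1..n}"
    proof (rule shrink)
      show "\<tau> permutes {1..Suc n}"
        unfolding \<tau>_def using \<sigma> rotation_permutes by (rule permutes_compose)
      show "\<tau> (Suc n) = Suc n"
        using i \<open>i = Suc n\<close> by (simp add: \<tau>_def rotation_def)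
    qed
    have \<tau>: "\<tau> k = \<sigma> k - 1" "\<sigma> k > 1" if "k \<in> {1..n}" for k
    proof -
      have "\<sigma> k \<in> {1..Suc n}" "\<sigma> k \<noteq> 1"
        using that range[of k] inj[of k i] i \<open>i = Suc n\<close> by auto
      then show "\<tau> k = \<sigma> k - 1" "\<sigma> k > 1"
        by (auto simp: \<tau>_def rotation_def)
    qed
    have "sign \<tau> = (-1) ^ (\<Sum>i\<in>{1..n} \<inter> B. i - 1)"
    proof (rule Suc.IH[OF \<open>\<tau> permutes {1..n}\<close>])
      fix k k' assume k: "k \<in> {1..n}" "k' \<in> {1..n}" "k < k'"
      with Suc.prems(2)[of k k'] \<tau>[OF k(1)] \<tau>[OF k(2)] show "\<tau> k' < \<tau> k \<longleftrightarrow> k' \<in> B" by auto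
    qed
    moreover have "sign \<tau> = (-1) ^ n * sign \<sigma>"
    proof -
      have "permutation (rotation n)" "permutation \<sigma>"
        by (rule permutes_imp_permutation[OF _ rotation_permutes] permutes_imp_permutation[OF _ \<sigma>], simp)+
      then show ?thesis by (simp add: \<tau>_def sign_compose sign_rotation)
    qed
    ultimately have "(-1) ^ n * ((-1) ^ n * sign \<sigma>) = (-1) ^ n * (-1) ^ (\<Sum>i\<in>{1..n} \<inter> B. i - 1)"
      by simp
    then have "sign \<sigma> = (-1) ^ (n + (\<Sum>i\<in>{1..n} \<inter> B. i - 1))"
      by (simp add: power_add flip: mult.assoc power_mult_distrib)
    moreover have "(\<Sum>i\<in>insert (Suc n) ({1..n} \<inter> B). i - 1) = n + (\<Sum>i\<in>{1..n} \<inter> B. i - 1)"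
      by (subst sum.insert) auto
    ultimately show ?thesis
      using True by (simp only: set_eq if_True)
  qed
qed

lemma crossing_point:
  assumes F: "F \<in> families n E" and k: "k \<in> {1..n}"
  defines "P \<equiv> hd (snd (paths F k))"
  shows "height P = 0" "start F k = alpha k \<Longrightarrow> fst P < 0" "start F k = beta k \<Longrightarrow> fst P > 0"
proof -
  note A = admissible_pathsD[OF familiesD(4)[OF F k]]
  show h: "height P = 0" using A(2,3) by (simp add: P_def)
  have mem: "P \<in> set (fst (paths F k))"
    using A(1,3) last_in_set[of "fst (paths F k)"] by (auto simp: P_def lattice_path_def)
  have "k \<ge> 1" using k by simp
  note side = initial_path_side[OF familiesD(4)[OF F k] this mem]
  show "fst P < 0" if "start F k = alpha k" using side(1)[OF that] h by (simp add: height_def)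
  show "fst P > 0" if "start F k = beta k" using side(2)[OF that] h by (simp add: height_def)
qed

text \<open>Starting points of one type are nested: a larger index starts lower and further out, at
  distance 2i from the diagonal. Paths of different types cross x + y = 0 on opposite sides of the
  origin.\<close>

lemma crossing_points_ordered:
  assumes F: "F \<in> disjoint_families n E" and k: "i \<in> {1..n}" "i' \<in> {1..n}" "i < i'"
  defines "x \<equiv> \<lambda>k. fst (hd (snd (paths F k)))"
  shows "start F i' = beta i' \<Longrightarrow> x i < x i'" "start F i' = alpha i' \<Longrightarrow> x i' < x i"
proof -
  have fam: "F \<in> families n E" and
    disj: "vertices (paths F i) \<inter> vertices (paths F i') = {}"
    using F k by (auto simp: disjoint_families_def)
  then have disj': "set (fst (paths F i)) \<inter> set (fst (paths F i')) = {}"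
    by (auto simp: vertices_def)
  note A = admissible_pathsD[OF familiesD(4)[OF fam k(1)]]
    and B = admissible_pathsD[OF familiesD(4)[OF fam k(2)]]
  have ge: "i \<ge> 1" "i' \<ge> 1" using k by auto
  have h: "height (hd (snd (paths F i))) = 0" "height (hd (snd (paths F i'))) = 0"
    using A B by simp_all
  have same: "\<epsilon> * x i < \<epsilon> * x i'"
    if "\<epsilon> \<in> {1, -1}" "initial_steps i (start F i) = {(1, 1), (\<epsilon>, - \<epsilon>)}"
      "initial_steps i' (start F i') = {(1, 1), (\<epsilon>, - \<epsilon>)}"
      "height (start F i') \<le> height (start F i)"
      "\<epsilon> * (fst (start F i) - snd (start F i)) = 2 * int i"
      "\<epsilon> * (fst (start F i') - snd (start F i')) = 2 * int i'" for \<epsilon>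
  proof -
    have "\<epsilon> * (fst (hd (snd (paths F i))) - snd (hd (snd (paths F i)))) <
        \<epsilon> * (fst (hd (snd (paths F i'))) - snd (hd (snd (paths F i'))))"
      by (rule initial_paths_ordered[OF that(1) A(1)[unfolded that(2) A(3)] B(1)[unfolded that(3) B(3)]
          A(4) B(4) h disj' that(4)]) (use k that(5,6) in auto)
    with h that(1) show ?thesis
      by (auto simp: height_def x_def)
  qed
  have st: "start F i \<in> {alpha i, beta i}"
    using familiesD(1)[OF fam k(1)] .
  show "x i < x i'" if b: "start F i' = beta i'"
  proof (cases "start F i = beta i")
    case True
    show ?thesis
      using same[of 1] b True k ge initial_steps_beta by (simp add: beta_def height_def)
  next
    case False
    with st have "x i < 0" using crossing_point(2)[OF fam k(1)] by (auto simp: x_def)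
    moreover have "x i' > 0" using crossing_point(3)[OF fam k(2) b] by (simp add: x_def)
    ultimately show ?thesis by simp
  qed
  show "x i' < x i" if a: "start F i' = alpha i'"
  proof (cases "start F i = alpha i")
    case True
    show ?thesis
      using same[of "-1"] a True k ge initial_steps_alpha by (simp add: alpha_def height_def)
  next
    case False
    with st have "x i > 0" using crossing_point(3)[OF fam k(1)] by (auto simp: x_def)
    moreover have "x i' < 0" using crossing_point(2)[OF fam k(2) a] by (simp add: x_def)
    ultimately show ?thesis by simp
  qed
qed

text \<open>The common features of all four endpoint choices that planarity needs. Two values are
  allowed for the even case, where neighbouring indices may share a first coordinate; the heights
  matter because the shortened endpoints lie at different levels.\<close>

definition staircase :: "nat \<Rightarrow> nat \<Rightarrow> (nat \<Rightarrow> point set) \<Rightarrow> bool" where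
  "staircase n l E \<longleftrightarrow>
     (\<forall>j\<in>{1..n}. \<forall>e\<in>E j. fst e \<in> {int n - int j + int l, int n - int j + int l + 1}) \<and>
     (\<forall>j\<in>{1..n}. \<forall>j'\<in>{1..n}. \<forall>e\<in>E j. \<forall>e'\<in>E j'. j < j' \<longrightarrow> height e \<le> height e')"

text \<open>Otherwise the path further right would go to the larger index, whose endpoint is no
  lower, and would end strictly to the right; but larger indices have first coordinates at most as
  large.\<close>

lemma perm_reverses_crossing_points:
  assumes E: "staircase n l E" and F: "F \<in> disjoint_families n E"
    and k: "k \<in> {1..n}" "k' \<in> {1..n}"
    and lt: "fst (hd (snd (paths F k))) < fst (hd (snd (paths F k')))"
  shows "perm F k' < perm F k"
proof (rule ccontr)
  assume nless: "\<not> perm F k' < perm F k"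
  have "k \<noteq> k'" using lt by auto
  have fam: "F \<in> families n E" and disj: "vertices (paths F k) \<inter> vertices (paths F k') = {}"
    using F k \<open>k \<noteq> k'\<close> by (auto simp: disjoint_families_def)
  have "perm F k \<noteq> perm F k'"
    using fam \<open>k \<noteq> k'\<close> permutes_inj[of "perm F" "{1..n}"] by (auto simp: families_def dest: injD)
  with nless have less: "perm F k < perm F k'" by simp
  note e = familiesD(2,3)[OF fam k(1)] and e' = familiesD(2,3)[OF fam k(2)]
  have "height (endpoint F k) \<le> height (endpoint F k')"
    using E e e' less unfolding staircase_def by blast
  moreover have "height (hd (snd (paths F k))) = height (hd (snd (paths F k')))"
    using crossing_point(1)[OF fam] k by simp
  ultimately have "fst (endpoint F k) < fst (endpoint F k')"
    using disj lt
    by (intro final_paths_ordered[OF admissible_pathsD(5)[OF familiesD(4)[OF fam k(1)]]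
          admissible_pathsD(5)[OF familiesD(4)[OF fam k(2)]]]) (auto simp: vertices_def)
  moreover have "fst (endpoint F k) \<ge> int n - int (perm F k) + int l"
    "fst (endpoint F k') \<le> int n - int (perm F k') + int l + 1"
    using E e e' unfolding staircase_def by force+
  ultimately show False using less by simp
qed

lemma sum_upto_eq_choose: "(\<Sum>i=1..n. i) = (n + 1) choose 2"
  by (induction n) (auto simp: numeral_2_eq_2)

text \<open>A path from \<open>beta\<close> crosses to the right of all paths of smaller index, one
  from \<open>alpha\<close> to their left, so \<open>perm F\<close> is extremal. The exponents i - 1
  together with one for each start at \<open>beta\<close> give the sum of i over these starts, and
  the sum over all of {1..n} is n + 1 choose 2.\<close>

lemma alpha_sign_eq:
  assumes E: "staircase n l E" and F: "F \<in> disjoint_families n E"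
  shows "alpha_sign n F = (-1) ^ ((n + 1) choose 2) * family_sign n F"
proof -
  have fam: "F \<in> families n E" using F by (simp add: disjoint_families_def)
  define A where "A = {i \<in> {1..n}. start F i = alpha i}"
  define B where "B = {i \<in> {1..n}. start F i = beta i}"
  have fin: "finite A" "finite B" by (simp_all add: A_def B_def)
  have AB: "A \<union> B = {1..n}" "A \<inter> B = {}"
    using familiesD(1)[OF fam] alpha_neq_beta by (force simp: A_def B_def)+
  have "sign (perm F) = (-1) ^ (\<Sum>i\<in>{1..n} \<inter> B. i - 1)"
  proof (rule sign_of_extremal_permutation)
    show "perm F permutes {1..n}" using fam by (simp add: families_def)
    fix i i' assume i: "i \<in> {1..n}" "i' \<in> {1..n}" "i < i'"
    note ord = crossing_points_ordered[OF F i] and rev = perm_reverses_crossing_points[OF E F]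
    show "perm F i' < perm F i \<longleftrightarrow> i' \<in> B"
    proof (cases "start F i' = beta i'")
      case True
      then show ?thesis using rev[OF i(1,2) ord(1)[OF True]] i by (simp add: B_def)
    next
      case False
      then have "start F i' = alpha i'" using familiesD(1)[OF fam i(2)] by simp
      then show ?thesis using rev[OF i(2,1) ord(2)] False by (simp add: B_def)
    qed
  qed
  moreover have "{1..n} \<inter> B = B" by (auto simp: B_def)
  ultimately have "family_sign n F = (-1) ^ ((\<Sum>i\<in>B. i - 1) + (\<Sum>i\<in>B. 1))"
    unfolding family_sign_def B_def[symmetric] by (simp add: power_add)
  also have "(\<Sum>i\<in>B. i - 1) + (\<Sum>i\<in>B. 1) = (\<Sum>i\<in>B. i)"
    unfolding sum.distrib[symmetric] by (intro sum.cong) (auto simp: B_def)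
  finally have "family_sign n F = (-1) ^ (\<Sum>i\<in>B. i)" .
  moreover have "(n + 1) choose 2 = (\<Sum>i\<in>A. i) + (\<Sum>i\<in>B. i)"
    using sum.union_disjoint[OF fin AB(2), of "\<lambda>i. i"] AB(1) sum_upto_eq_choose[of n] by simp
  moreover have "alpha_sign n F = (-1) ^ (\<Sum>i\<in>A. i)"
    by (simp add: alpha_sign_def A_def)
  ultimately show ?thesis
    by (simp add: power_add mult.assoc flip: power_mult_distrib)
qed

section \<open>Assembly of the identities\<close>

lemma segment_weight_final_eq_1:
  assumes "lattice_path {(1, 0), (0, 1)} a b p"
    and "w = 1 \<or> height b \<le> int j - 1"
  shows "segment_weight X w j p = 1"
  using assms
proof (induction p arbitrary: a)
  case (Cons u p)
  show ?case
  proof (cases "p = []")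
    case False
    then obtain s where s: "s \<in> {(1, 0), (0, 1)}" "lattice_path {(1, 0), (0, 1)} (a + s) b p" "u = a"
      using Cons.prems(1) by (auto simp: lattice_path_Cons)
    have hd_p: "hd p = a + s" and "b \<in> set p"
      using s(2) last_in_set[OF False] by (simp_all add: lattice_path_def)
    then have le: "height (a + s) \<le> height b"
      using final_path_bounds(1)[OF s(2)] by blast
    have "step_weight X w j u (hd p) = 1"
    proof (cases "w = 1")
      case True
      then show ?thesis using s(1) by (auto simp: step_weight_def hd_p s(3))
    next
      case False
      \<comment> \<open>The weight w depends on the height where a step begins, so an endpoint
        exactly at height j - 1 still gives only weights 1.\<close>
      then have "\<not> int j - 1 \<le> height a"
        using le s(1) Cons.prems(2) by (auto simp: height_def)
      then show ?thesis using s(1) by (auto simp: step_weight_def hd_p s(3))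
    qed
    with Cons.IH[OF s(2) Cons.prems(2)] False show ?thesis
      by (simp add: segment_weight_Cons)
  qed simp
qed simp

text \<open>Injectivity of \<open>fst\<close> turns sums over endpoints into sums over first
  coordinates, the only data that \<open>end_sum\<close> uses.\<close>

lemma R_eq_sum_families:
  fixes X :: "nat \<Rightarrow> 'a::field" and E :: "nat \<Rightarrow> point set" and \<rho> :: "nat \<Rightarrow> 'a" and l :: nat
  assumes "n \<ge> 1" "generic n X"
    and fin: "\<And>j. j \<in> {1..n} \<Longrightarrow> finite (E j) \<and> inj_on fst (E j)"
    and h: "\<And>j e. j \<in> {1..n} \<Longrightarrow> e \<in> E j \<Longrightarrow> height e = int n - 1 \<or> w = 0 \<and> height e = int j - 1"
    and entry: "\<And>i j. i \<in> {1..n} \<Longrightarrow> j \<in> {1..n} \<Longrightarrow> R_entry X w n m i j =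
      X i ^ (n + l - 1) * ((X i - 1) * \<rho> i) *
        (\<Sum>x\<in>fst ` E j. end_sum w n j (resolvent (X i + inverse (X i))) x)"
  defines "C \<equiv> (\<Prod>i=1..n. X i ^ l * (inverse (X i) + 1 + w + X i) * \<rho> i)"
  shows "finite (families n E)"
    and "R X w n m = (-1) ^ ((n + 1) choose 2) * C *
      (\<Sum>F\<in>families n E. of_int (family_sign n F) * family_weight X w n F)"
    and "R X w n m = (-1) ^ ((n + 1) choose 2) * C *
      (\<Sum>F\<in>initially_disjoint_families n E. of_int (family_sign n F) * family_weight X w n F)"
proof -
  have E: "finite (E j) \<and> (\<forall>e\<in>E j. height e \<ge> 0)" if "j \<in> {1..n}" for j
  proof (intro conjI ballI)
    show "height e \<ge> 0" if "e \<in> E j" for e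
      using h[OF \<open>j \<in> {1..n}\<close> that] \<open>j \<in> {1..n}\<close> by auto
  qed (use fin[OF that] in simp)
  show finF: "finite (families n E)"
    by (rule finite_families[OF E])
  have X: "X i \<noteq> 0" if "i \<in> {1..n}" for i
    using assms(2) that by (simp add: generic_def)
  have "(\<Sum>F\<in>families n E. of_int (family_sign n F) * family_weight X w n F) =
      Det n (\<lambda>i j. \<Sum>e\<in>E j. path_sum X w i j e)"
    by (rule sum_families[OF E])
  also have "\<dots> = Det n (\<lambda>i j. \<Sum>x\<in>fst ` E j. end_sum w n j (init_fps X i) x)"
  proof (rule Det_cong)
    fix i j assume ij: "i \<in> {1..n}" "j \<in> {1..n}"
    have "(\<Sum>e\<in>E j. path_sum X w i j e) = (\<Sum>e\<in>E j. end_sum w n j (init_fps X i) (fst e))"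
      by (intro sum.cong refl path_sum_eq_end_sum[OF ij X h[OF ij(2)]])
    also have "\<dots> = (\<Sum>x\<in>fst ` E j. end_sum w n j (init_fps X i) x)"
      using fin[OF ij(2)] by (simp add: sum.reindex)
    finally show "(\<Sum>e\<in>E j. path_sum X w i j e) = (\<Sum>x\<in>fst ` E j. end_sum w n j (init_fps X i) x)" .
  qed
  finally have S: "(\<Sum>F\<in>families n E. of_int (family_sign n F) * family_weight X w n F) =
      Det n (\<lambda>i j. \<Sum>x\<in>fst ` E j. end_sum w n j (init_fps X i) x)" .
  show R: "R X w n m = (-1) ^ ((n + 1) choose 2) * C *
      (\<Sum>F\<in>families n E. of_int (family_sign n F) * family_weight X w n F)"
    unfolding S C_def by (rule R_eq_Det[OF assms(1,2) entry])
  then show "R X w n m = (-1) ^ ((n + 1) choose 2) * C *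
      (\<Sum>F\<in>initially_disjoint_families n E. of_int (family_sign n F) * family_weight X w n F)"
    unfolding sum_initially_disjoint_families[OF finF] .
qed

text \<open>In the version with \<open>alpha_sign\<close> the sign from \<open>alpha_sign_eq\<close>
  cancels the overall sign.\<close>

lemma R_eq_sum_disjoint_families:
  fixes X :: "nat \<Rightarrow> 'a::field" and E :: "nat \<Rightarrow> point set" and \<rho> :: "nat \<Rightarrow> 'a" and l :: nat
  assumes "n \<ge> 1" "generic n X"
    and fin: "\<And>j. j \<in> {1..n} \<Longrightarrow> finite (E j) \<and> inj_on fst (E j)"
    and h: "\<And>j e. j \<in> {1..n} \<Longrightarrow> e \<in> E j \<Longrightarrow>
      w = 1 \<and> height e = int n - 1 \<or> w = 0 \<and> height e = int j - 1"
    and stair: "staircase n l E"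
    and entry: "\<And>i j. i \<in> {1..n} \<Longrightarrow> j \<in> {1..n} \<Longrightarrow> R_entry X w n m i j =
      X i ^ (n + l - 1) * ((X i - 1) * \<rho> i) *
        (\<Sum>x\<in>fst ` E j. end_sum w n j (resolvent (X i + inverse (X i))) x)"
  defines "C \<equiv> (\<Prod>i=1..n. X i ^ l * (inverse (X i) + 1 + w + X i) * \<rho> i)"
  shows "R X w n m = (-1) ^ ((n + 1) choose 2) * C *
      (\<Sum>F\<in>disjoint_families n E. of_int (family_sign n F) * family_weight X w n F)" (is ?thesis1)
    and "R X w n m = C * (\<Sum>F\<in>disjoint_families n E. of_int (alpha_sign n F) * family_weight X w n F)"
proof -
  have h': "height e = int n - 1 \<or> w = 0 \<and> height e = int j - 1" if "j \<in> {1..n}" "e \<in> E j" for j e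
    using h[OF that] by auto
  note R = R_eq_sum_families[OF assms(1,2) fin h' entry, folded C_def]
  have one: "segment_weight X w (perm F k) (snd (paths F k)) = 1"
    if "F \<in> families n E" "k \<in> {1..n}" for F k
    using h[OF familiesD(3,2)[OF that]]
    by (intro segment_weight_final_eq_1[OF admissible_pathsD(5)[OF familiesD(4)[OF that]]]) auto
  show *: ?thesis1
    using R(3) sum_disjoint_families[OF R(1) one] by simp
  have "(\<Sum>F\<in>disjoint_families n E. of_int (alpha_sign n F) * family_weight X w n F) =
      (-1) ^ ((n + 1) choose 2) *
      (\<Sum>F\<in>disjoint_families n E. of_int (family_sign n F) * family_weight X w n F)"
    unfolding sum_distrib_left using alpha_sign_eq[OF stair]
    by (intro sum.cong refl) (simp add: mult.assoc)
  then show "R X w n m = C * (\<Sum>F\<in>disjoint_families n E. of_int (alpha_sign n F) * family_weight X w n F)"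
    unfolding * by (simp only: mult_ac)
qed

theorem theorem4p1:
  fixes n l :: nat and w :: "'a::field" and X :: "nat \<Rightarrow> 'a"
  assumes "n \<ge> 1" and "generic n X"
  defines "C_odd \<equiv> (\<Prod>i=1..n. X i ^ l * (inverse (X i) + 1 + w + X i) * (1 + X i))"
    and "C_even \<equiv> (\<Prod>i=1..n. X i ^ l * (inverse (X i) + 1 + w + X i))"
  shows
    "(R X w n (2 * l + 1) = (-1) ^ ((n + 1) choose 2) * C_odd *
        (\<Sum>F\<in>initially_disjoint_families n (E_odd n l).
           of_int (family_sign n F) * family_weight X w n F) \<and>
      R X w n (2 * l + 1) = (-1) ^ ((n + 1) choose 2) * C_odd *
        (\<Sum>F\<in>families n (E_odd n l).
           of_int (family_sign n F) * family_weight X w n F) \<and>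
      (w = 1 \<longrightarrow>
        R X w n (2 * l + 1) = (-1) ^ ((n + 1) choose 2) * C_odd *
          (\<Sum>F\<in>disjoint_families n (E_odd n l).
             of_int (family_sign n F) * family_weight X w n F)) \<and>
      (w = 0 \<longrightarrow>
        R X w n (2 * l + 1) = (-1) ^ ((n + 1) choose 2) * C_odd *
          (\<Sum>F\<in>disjoint_families n (E'_odd n l).
             of_int (family_sign n F) * family_weight X w n F)) \<and>
      (w = 1 \<longrightarrow>
        R X w n (2 * l + 1) = C_odd *
          (\<Sum>F\<in>disjoint_families n (E_odd n l).
             of_int (alpha_sign n F) * family_weight X w n F)) \<and>
      (w = 0 \<longrightarrow>
        R X w n (2 * l + 1) = C_odd *
          (\<Sum>F\<in>disjoint_families n (E'_odd n l).
             of_int (alpha_sign n F) * family_weight X w n F))) \<and>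
     (R X w n (2 * l) = (-1) ^ ((n + 1) choose 2) * C_even *
        (\<Sum>F\<in>initially_disjoint_families n (E_even n l).
           of_int (family_sign n F) * family_weight X w n F) \<and>
      R X w n (2 * l) = (-1) ^ ((n + 1) choose 2) * C_even *
        (\<Sum>F\<in>families n (E_even n l).
           of_int (family_sign n F) * family_weight X w n F) \<and>
      (w = 1 \<longrightarrow>
        R X w n (2 * l) = (-1) ^ ((n + 1) choose 2) * C_even *
          (\<Sum>F\<in>disjoint_families n (E_even n l).
             of_int (family_sign n F) * family_weight X w n F)) \<and>
      (w = 0 \<longrightarrow>
        R X w n (2 * l) = (-1) ^ ((n + 1) choose 2) * C_even *
          (\<Sum>F\<in>disjoint_families n (E'_even n l).
             of_int (family_sign n F) * family_weight X w n F)) \<and>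
      (w = 1 \<longrightarrow>
        R X w n (2 * l) = C_even *
          (\<Sum>F\<in>disjoint_families n (E_even n l).
             of_int (alpha_sign n F) * family_weight X w n F)) \<and>
      (w = 0 \<longrightarrow>
        R X w n (2 * l) = C_even *
          (\<Sum>F\<in>disjoint_families n (E'_even n l).
             of_int (alpha_sign n F) * family_weight X w n F)))"
proof -
  \<comment> \<open>The endpoints \<open>E\<close> and their shortened versions have the same first
    coordinates, so both use the same entry formulas.\<close>
  define T where "T j = int n - int j + int l + 1" for j
  have X: "X i \<noteq> 0" if "i \<in> {1..n}" for i
    using assms(2) that by (simp add: generic_def)
  have fst_odd: "fst ` E_odd n l j = {T j}" "fst ` E'_odd n l j = {T j}" for j
    by (simp_all add: E_odd_def E'_odd_def T_def)
  have fst_even: "fst ` E_even n l j = {T j, T j - 1}" "fst ` E'_even n l j = {T j, T j - 1}" for j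
    by (simp_all add: E_even_def E'_even_def T_def)
  have entry_odd: "R_entry X w n (2 * l + 1) i j = X i ^ (n + l - 1) * ((X i - 1) * (1 + X i)) *
      (\<Sum>x\<in>{T j}. end_sum w n j (resolvent (X i + inverse (X i))) x)"
    if "i \<in> {1..n}" "j \<in> {1..n}" for i j
    using R_entry_eq(1)[of X i j n w l, folded T_def] X that by simp
  have entry_even: "R_entry X w n (2 * l) i j = X i ^ (n + l - 1) * ((X i - 1) * 1) *
      (\<Sum>x\<in>{T j, T j - 1}. end_sum w n j (resolvent (X i + inverse (X i))) x)"
    if "i \<in> {1..n}" "j \<in> {1..n}" for i j
    using R_entry_eq(2)[of X i j n w l, folded T_def] X that by simp
  have fin: "finite (E_odd n l j) \<and> inj_on fst (E_odd n l j)"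
    "finite (E'_odd n l j) \<and> inj_on fst (E'_odd n l j)"
    "finite (E_even n l j) \<and> inj_on fst (E_even n l j)"
    "finite (E'_even n l j) \<and> inj_on fst (E'_even n l j)" for j
    by (simp_all add: E_odd_def E'_odd_def E_even_def E'_even_def)
  have height: "e \<in> E_odd n l j \<Longrightarrow> height e = int n - 1" "e \<in> E'_odd n l j \<Longrightarrow> height e = int j - 1"
    "e \<in> E_even n l j \<Longrightarrow> height e = int n - 1" "e \<in> E'_even n l j \<Longrightarrow> height e = int j - 1" for e j
    by (auto simp: E_odd_def E'_odd_def E_even_def E'_even_def height_def)
  have stair: "staircase n l (E_odd n l)" "staircase n l (E'_odd n l)"
    "staircase n l (E_even n l)" "staircase n l (E'_even n l)"
    by (auto simp: staircase_def E_odd_def E'_odd_def E_even_def E'_even_def height_def)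
  have C_odd: "C_odd = (\<Prod>i=1..n. X i ^ l * (inverse (X i) + 1 + w + X i) * (1 + X i))"
    by (simp add: C_odd_def)
  \<comment> \<open>The factor 1 gives the shape with \<rho> = 1, as needed for folding the general
    results.\<close>
  have C_even: "C_even = (\<Prod>i=1..n. X i ^ l * (inverse (X i) + 1 + w + X i) * 1)"
    by (simp add: C_even_def)
  note odd = R_eq_sum_families[OF assms(1,2), where \<rho> = "\<lambda>i. 1 + X i" and l = l and w = w and m = "2 * l + 1",
      folded C_odd]
    and even = R_eq_sum_families[OF assms(1,2), where \<rho> = "\<lambda>i. 1" and l = l and w = w and m = "2 * l",
      folded C_even]
    and disjoint_odd = R_eq_sum_disjoint_families[OF assms(1,2), where \<rho> = "\<lambda>i. 1 + X i" and l = l and w = w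
      and m = "2 * l + 1", folded C_odd]
    and disjoint_even = R_eq_sum_disjoint_families[OF assms(1,2), where \<rho> = "\<lambda>i. 1" and l = l and w = w
      and m = "2 * l", folded C_even]
  show ?thesis
  proof (intro conjI impI)
    show "R X w n (2 * l + 1) = (-1) ^ ((n + 1) choose 2) * C_odd *
        (\<Sum>F\<in>initially_disjoint_families n (E_odd n l). of_int (family_sign n F) * family_weight X w n F)"
      "R X w n (2 * l + 1) = (-1) ^ ((n + 1) choose 2) * C_odd *
        (\<Sum>F\<in>families n (E_odd n l). of_int (family_sign n F) * family_weight X w n F)"
      by (rule odd(3,2)[OF fin(1) disjI1[OF height(1)] entry_odd[folded fst_odd(1)]]; assumption)+
    show "R X w n (2 * l) = (-1) ^ ((n + 1) choose 2) * C_even *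
        (\<Sum>F\<in>initially_disjoint_families n (E_even n l). of_int (family_sign n F) * family_weight X w n F)"
      "R X w n (2 * l) = (-1) ^ ((n + 1) choose 2) * C_even *
        (\<Sum>F\<in>families n (E_even n l). of_int (family_sign n F) * family_weight X w n F)"
      by (rule even(3,2)[OF fin(3) disjI1[OF height(3)] entry_even[folded fst_even(1)]]; assumption)+
  next
    assume w: "w = 1"
    show "R X w n (2 * l + 1) = (-1) ^ ((n + 1) choose 2) * C_odd *
        (\<Sum>F\<in>disjoint_families n (E_odd n l). of_int (family_sign n F) * family_weight X w n F)"
      "R X w n (2 * l + 1) = C_odd *
        (\<Sum>F\<in>disjoint_families n (E_odd n l). of_int (alpha_sign n F) * family_weight X w n F)"
      by (rule disjoint_odd[OF fin(1) disjI1[OF conjI[OF w height(1)]] stair(1) entry_odd[folded fst_odd(1)]]; assumption)+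
    show "R X w n (2 * l) = (-1) ^ ((n + 1) choose 2) * C_even *
        (\<Sum>F\<in>disjoint_families n (E_even n l). of_int (family_sign n F) * family_weight X w n F)"
      "R X w n (2 * l) = C_even *
        (\<Sum>F\<in>disjoint_families n (E_even n l). of_int (alpha_sign n F) * family_weight X w n F)"
      by (rule disjoint_even[OF fin(3) disjI1[OF conjI[OF w height(3)]] stair(3) entry_even[folded fst_even(1)]]; assumption)+
  next
    assume w: "w = 0"
    show "R X w n (2 * l + 1) = (-1) ^ ((n + 1) choose 2) * C_odd *
        (\<Sum>F\<in>disjoint_families n (E'_odd n l). of_int (family_sign n F) * family_weight X w n F)"
      "R X w n (2 * l + 1) = C_odd *
        (\<Sum>F\<in>disjoint_families n (E'_odd n l). of_int (alpha_sign n F) * family_weight X w n F)"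
      by (rule disjoint_odd[OF fin(2) disjI2[OF conjI[OF w height(2)]] stair(2) entry_odd[folded fst_odd(2)]]; assumption)+
    show "R X w n (2 * l) = (-1) ^ ((n + 1) choose 2) * C_even *
        (\<Sum>F\<in>disjoint_families n (E'_even n l). of_int (family_sign n F) * family_weight X w n F)"
      "R X w n (2 * l) = C_even *
        (\<Sum>F\<in>disjoint_families n (E'_even n l). of_int (alpha_sign n F) * family_weight X w n F)"
      by (rule disjoint_even[OF fin(4) disjI2[OF conjI[OF w height(4)]] stair(4) entry_even[folded fst_even(2)]]; assumption)+
  qed
qed

end
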